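(* There is an absolute constant $C$ such that for every integer $N\ge2$ and real $\Delta>0$ there is a pair $(E,D)$, $E:\mathcal P([N])\times[N]\to\{0,1\}^*$, $D:\mathcal P([N])\times\{0,1\}^*\to[N]$, with $D(Q,E(P,m))=m$ for all $\Delta$-close $P,Q\in\mathcal P([N])$ and all $m\in[N]$ (zero error), such that: for every $P\in\mathcal F=\mathrm{Flat}_N\cup\mathrm{Geo}_N\cup\mathrm{Bin}_N$, $\mathbb E_{m\sim P}[|E(P,m)|]\le C\,2^{H(P)}\lceil\Delta\log^*N\rceil$; and moreover, for every $P\in\mathcal P([N])$ that is $(\Delta\log^*N)$-close to some $\tilde P\in\mathcal F$, $\mathbb E_{m\sim P}[|E(P,m)|]\le C\,2^{H(\tilde P)}\lceil\Delta\log^*N\rceil$.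
   Context: $\mathcal P([N])$ is the set of probability distributions on $[N]=\{1,\dots,N\}$; $\{0,1\}^*$ is the set of finite binary strings. $P,Q$ are $\Delta$-close if for all $m$, $\log_2(P(m)/Q(m))\le\Delta$ and $\log_2(Q(m)/P(m))\le\Delta$. $H(P)=\sum_mP(m)\log_2(1/P(m))$. $\log^*N$ is the least integer $i$ such that the $i$-fold iterated base-2 logarithm of $N$ is at most $1$. $\mathrm{Flat}_N$: distributions uniform on some subset of $[N]$. $\mathrm{Geo}_N$: distributions for which there are $\alpha\in(0,1)$ and a permutation $\pi$ of $[N]$ with $P(\pi(k+1))=\alpha P(\pi(k))$ for all $k\in[N-1]$. $\mathrm{Bin}_N$: distributions for which there are $p\in(0,1)$ and a bijection $\pi:\{0,\dots,N-1\}\to[N]$ with $P(\pi(k))=\binom{N-1}{k}p^k(1-p)^{N-1-k}$. *)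

theory Defs
  imports Complex_Main
begin

definition is_dist :: "nat \<Rightarrow> (nat \<Rightarrow> real) \<Rightarrow> bool" where
  "is_dist N P \<longleftrightarrow> (\<forall>m\<in>{1..N}. P m \<ge> 0) \<and> (\<forall>m. m \<notin> {1..N} \<longrightarrow> P m = 0)
     \<and> (\<Sum>m=1..N. P m) = 1"

text \<open>Delta-closeness: log2(P m / Q m) <= Delta and log2(Q m / P m) <= Delta for all m,
with the extended-real convention (so a zero on one side forces a zero on the other).\<close>
definition close :: "nat \<Rightarrow> real \<Rightarrow> (nat \<Rightarrow> real) \<Rightarrow> (nat \<Rightarrow> real) \<Rightarrow> bool" where
  "close N \<Delta> P Q \<longleftrightarrow> (\<forall>m\<in>{1..N}. P m \<le> 2 powr \<Delta> * Q m \<and> Q m \<le> 2 powr \<Delta> * P m)"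

definition entropy :: "nat \<Rightarrow> (nat \<Rightarrow> real) \<Rightarrow> real" where
  "entropy N P = (\<Sum>m\<in>{m\<in>{1..N}. P m > 0}. P m * log 2 (1 / P m))"

definition log_star :: "nat \<Rightarrow> nat" where
  "log_star N = (LEAST i. ((log 2) ^^ i) (real N) \<le> 1)"

definition Flat :: "nat \<Rightarrow> (nat \<Rightarrow> real) set" where
  "Flat N = {P. is_dist N P \<and> (\<exists>S. S \<subseteq> {1..N} \<and> S \<noteq> {} \<and>
      (\<forall>m\<in>{1..N}. P m = (if m \<in> S then 1 / real (card S) else 0)))}"

definition Geo :: "nat \<Rightarrow> (nat \<Rightarrow> real) set" where
  "Geo N = {P. is_dist N P \<and> (\<exists>\<alpha> \<pi>. 0 < \<alpha> \<and> \<alpha> < 1 \<and> bij_betw \<pi> {1..N} {1..N} \<and>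
      (\<forall>k\<in>{1..N-1}. P (\<pi> (k+1)) = \<alpha> * P (\<pi> k)))}"

definition Bin :: "nat \<Rightarrow> (nat \<Rightarrow> real) set" where
  "Bin N = {P. is_dist N P \<and> (\<exists>p \<pi>. 0 < p \<and> p < 1 \<and> bij_betw \<pi> {0..N-1} {1..N} \<and>
      (\<forall>k\<in>{0..N-1}. P (\<pi> k) = real ((N-1) choose k) * p ^ k * (1-p) ^ (N-1-k)))}"

definition Fam :: "nat \<Rightarrow> (nat \<Rightarrow> real) set" where
  "Fam N = Flat N \<union> Geo N \<union> Bin N"

definition exp_len :: "nat \<Rightarrow> (nat \<Rightarrow> real) \<Rightarrow> (nat \<Rightarrow> bool list) \<Rightarrow> real" where
  "exp_len N P c = (\<Sum>m=1..N. P m * real (length (c m)))"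

end

theory Submission
  imports Defs "HOL-Library.FuncSet"
begin

text \<open>
  Put \<open>K = log_star N\<close> and \<open>W = \<lceil>\<Delta> K\<rceil>\<close>.  To send \<open>m\<close>, the encoder rounds \<open>P m\<close> down to a
  threshold \<open>2 powr (- W j)\<close> and cuts \<open>[N]\<close> into levels of ratio \<open>2 powr (2 \<Delta>)\<close> below it.
  Two distributions that are \<open>\<Delta>\<close>-close to a common one have level functions differing by at most
  one everywhere, so it suffices to colour the pairs (message, level function) properly
  with respect to this relation.  A Linial-style colour reduction with cover-free families replaces
  \<open>n\<close> colours by \<open>O((D log n)^2)\<close>, where \<open>D \<le> d 3^d\<close> and \<open>d\<close> is the number of messages in the first
  \<open>K\<close> levels: each of them has at most three possible levels at a neighbour.  Each round consumes one
  level, and after \<open>K\<close> rounds the colours fit into \<open>O(d)\<close> bits.  The codeword consists of \<open>j\<close>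
  and \<open>d\<close> in unary and the colour.

  The families Flat, Geo and Bin are log-concave after reordering.  If such a distribution has maximum
  \<open>M\<close>, then at most \<open>5 (1 + u) / M\<close> points have probability at least \<open>M * 2 powr (- u)\<close>.  Hence the
  expectation of \<open>d\<close> is \<open>O(W / M)\<close>, and \<open>1 / M \<le> 2 powr H\<close>.
\<close>

section \<open>Cover-free families\<close>

lemma card_PiE_fixed_on:
  fixes u :: "nat \<Rightarrow> nat"
  assumes "S \<subseteq> {..<t}"
  shows "card {v \<in> {..<t} \<rightarrow>\<^sub>E {..<q}. \<forall>i\<in>S. v i = u i} \<le> q ^ (t - card S)"
proof -
  let ?X = "{v \<in> {..<t} \<rightarrow>\<^sub>E {..<q}. \<forall>i\<in>S. v i = u i}"
  let ?r = "\<lambda>v. restrict v ({..<t} - S)"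
  have "inj_on ?r ?X"
  proof (rule inj_onI, rule ext)
    fix v w i assume v: "v \<in> ?X" and w: "w \<in> ?X" and eq: "?r v = ?r w"
    show "v i = w i"
    proof (cases "i < t")
      case True
      with v w fun_cong[OF eq, of i] show ?thesis by (cases "i \<in> S") auto
    next
      case False
      with v w show ?thesis by (auto simp: PiE_def extensional_def)
    qed
  qed
  moreover have "?r ` ?X \<subseteq> ({..<t} - S) \<rightarrow>\<^sub>E {..<q}" by (auto simp: PiE_def Pi_def)
  ultimately have "card ?X \<le> card (({..<t} - S) \<rightarrow>\<^sub>E {..<q})"
    by (rule card_inj_on_le) (simp add: finite_PiE)
  also have "\<dots> = q ^ (t - card S)"
    using assms by (simp add: card_PiE card_Diff_subset finite_subset[OF assms])
  finally show ?thesis .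
qed

text \<open>Union bound over the \<open>s\<close>-element sets of positions on which
  \<open>v\<close> agrees with \<open>u\<close>; there are \<open>t choose s\<close> of them, at
  most \<open>t ^ s\<close> when \<open>s \<le> t\<close>.\<close>

lemma card_PiE_agreeing:
  fixes u :: "nat \<Rightarrow> nat"
  shows "card {v \<in> {..<t} \<rightarrow>\<^sub>E {..<q}. s \<le> card {i. i < t \<and> v i = u i}} \<le> t ^ s * q ^ (t - s)"
proof -
  let ?T = "{S. S \<subseteq> {..<t} \<and> card S = s}"
  let ?X = "\<lambda>S. {v \<in> {..<t} \<rightarrow>\<^sub>E {..<q}. \<forall>i\<in>S. v i = u i}"
  have finT: "finite ?T" by (rule finite_subset[of _ "Pow {..<t}"]) auto
  have finX: "finite (?X S)" for S by (simp add: finite_PiE)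
  have "{v \<in> {..<t} \<rightarrow>\<^sub>E {..<q}. s \<le> card {i. i < t \<and> v i = u i}} \<subseteq> (\<Union>S\<in>?T. ?X S)"
  proof
    fix v assume v: "v \<in> {v \<in> {..<t} \<rightarrow>\<^sub>E {..<q}. s \<le> card {i. i < t \<and> v i = u i}}"
    then obtain S where "S \<subseteq> {i. i < t \<and> v i = u i}" "card S = s"
      using obtain_subset_with_card_n by (metis (no_types, lifting) mem_Collect_eq)
    with v show "v \<in> (\<Union>S\<in>?T. ?X S)" by auto
  qed
  then have "card {v \<in> {..<t} \<rightarrow>\<^sub>E {..<q}. s \<le> card {i. i < t \<and> v i = u i}} \<le> card (\<Union>S\<in>?T. ?X S)"
    using finT finX by (intro card_mono) auto
  also have "\<dots> \<le> (\<Sum>S\<in>?T. card (?X S))" by (rule card_UN_le[OF finT])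
  also have "\<dots> \<le> (\<Sum>S\<in>?T. q ^ (t - s))"
  proof (rule sum_mono)
    fix S assume "S \<in> ?T"
    then show "card (?X S) \<le> q ^ (t - s)" using card_PiE_fixed_on[of S t q u] by simp
  qed
  also have "\<dots> = (t choose s) * q ^ (t - s)" using n_subsets[of "{..<t}" s] by simp
  also have "\<dots> \<le> t ^ s * q ^ (t - s)"
  proof (cases "s \<le> t")
    case True then show ?thesis by (intro mult_right_mono binomial_le_pow) auto
  qed (simp add: binomial_eq_0)
  finally show ?thesis .
qed

text \<open>The Gilbert--Varshamov argument: words are chosen greedily.\<close>

lemma code_with_few_agreements:
  assumes "1 \<le> s" "s \<le> t" "n \<le> 2 ^ s"
  shows "\<exists>w :: nat \<Rightarrow> nat \<Rightarrow> nat. (\<forall>a<n. w a \<in> {..<t} \<rightarrow>\<^sub>E {..<2 * t}) \<and>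
     (\<forall>a<n. \<forall>b<n. a \<noteq> b \<longrightarrow> card {i. i < t \<and> w a i = w b i} < s)"
  using assms(3)
proof (induction n)
  case (Suc n)
  have "n \<le> 2 ^ s" using Suc.prems by simp
  with Suc.IH obtain w :: "nat \<Rightarrow> nat \<Rightarrow> nat" where
    w: "\<forall>a<n. w a \<in> {..<t} \<rightarrow>\<^sub>E {..<2 * t}" and
    w': "\<forall>a<n. \<forall>b<n. a \<noteq> b \<longrightarrow> card {i. i < t \<and> w a i = w b i} < s"
    by blast
  let ?Y = "{..<t} \<rightarrow>\<^sub>E {..<2 * t} :: (nat \<Rightarrow> nat) set"
  let ?B = "\<lambda>a. {v \<in> ?Y. s \<le> card {i. i < t \<and> v i = w a i}}"
  have "card (\<Union>a<n. ?B a) \<le> (\<Sum>a<n. card (?B a))" by (rule card_UN_le) simp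
  also have "\<dots> \<le> (\<Sum>a<n. t ^ s * (2 * t) ^ (t - s))" by (intro sum_mono card_PiE_agreeing)
  also have "\<dots> = n * (t ^ s * (2 * t) ^ (t - s))" by simp
  \<comment> \<open>This is why the alphabet has size \<open>2 * t\<close>: each earlier word
    excludes at most one part in \<open>2 ^ s\<close> of all words, and there are fewer than
    \<open>2 ^ s\<close> earlier words.\<close>
  also have "\<dots> < 2 ^ s * (t ^ s * (2 * t) ^ (t - s))"
    using Suc.prems assms by (intro mult_strict_right_mono) auto
  also have "\<dots> = (2 * t) ^ s * (2 * t) ^ (t - s)" by (simp add: power_mult_distrib)
  also have "\<dots> = (2 * t) ^ t" using assms by (simp only: power_add[symmetric] le_add_diff_inverse)
  also have "\<dots> = card ?Y" by (simp add: card_PiE)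
  finally have "\<not> ?Y \<subseteq> (\<Union>a<n. ?B a)"
    using card_mono[of "\<Union>a<n. ?B a" ?Y] by (auto simp: finite_PiE)
  then obtain v where v: "v \<in> ?Y" and "v \<notin> (\<Union>a<n. ?B a)" by blast
  then have v': "card {i. i < t \<and> v i = w a i} < s" if "a < n" for a
    using that by (auto simp: not_le)
  then have "card {i. i < t \<and> w a i = v i} < s" if "a < n" for a
    using that by (simp add: eq_commute)
  with v v' w w' have "(\<forall>a<Suc n. (w(n := v)) a \<in> ?Y) \<and>
     (\<forall>a<Suc n. \<forall>b<Suc n. a \<noteq> b \<longrightarrow> card {i. i < t \<and> (w(n := v)) a i = (w(n := v)) b i} < s)"
    by (auto simp: less_Suc_eq)
  then show ?case by blast
qed auto

text \<open>Take a code of length \<open>t = D * s\<close> and let \<open>F a\<close> be the graph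
  of the word \<open>w a\<close>. Another word meets this graph in fewer than \<open>s\<close>
  points, so \<open>D\<close> words cover at most \<open>D * (s - 1) < t\<close> of its
  \<open>t\<close> points.\<close>

lemma cover_free_family:
  assumes "1 \<le> s" "1 \<le> D" "n \<le> 2 ^ s"
  shows "\<exists>F :: nat \<Rightarrow> nat set. (\<forall>a<n. F a \<subseteq> {..<2 * D\<^sup>2 * s\<^sup>2}) \<and>
    (\<forall>a<n. \<forall>B. B \<subseteq> {..<n} \<and> card B \<le> D \<and> a \<notin> B \<longrightarrow> \<not> F a \<subseteq> (\<Union>b\<in>B. F b))"
proof -
  define t where "t = D * s"
  have st: "s \<le> t" "0 < t" using assms by (auto simp: t_def)
  obtain w :: "nat \<Rightarrow> nat \<Rightarrow> nat" where
    w: "\<forall>a<n. w a \<in> {..<t} \<rightarrow>\<^sub>E {..<2 * t}" and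
    w': "\<forall>a<n. \<forall>b<n. a \<noteq> b \<longrightarrow> card {i. i < t \<and> w a i = w b i} < s"
    using code_with_few_agreements[OF assms(1) st(1) assms(3)] by blast
  \<comment> \<open>The point \<open>(i, w a i)\<close> of the graph is packed into one number, so
    the ground set has \<open>t * (2 * t)\<close> elements.\<close>
  define F where "F a = (\<lambda>i. i * (2 * t) + w a i) ` {..<t}" for a
  have wlt: "w a i < 2 * t" if "a < n" "i < t" for a i using w that by fastforce
  have "F a \<subseteq> {..<2 * D\<^sup>2 * s\<^sup>2}" if "a < n" for a
  proof -
    have "i * (2 * t) + w a i < 2 * D\<^sup>2 * s\<^sup>2" if "i < t" for i
    proof -
      have "i * (2 * t) + w a i < Suc i * (2 * t)" using wlt[OF \<open>a < n\<close> that] by simp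
      also have "\<dots> \<le> t * (2 * t)" using that by (intro mult_right_mono) auto
      also have "\<dots> = 2 * D\<^sup>2 * s\<^sup>2" by (simp add: t_def power2_eq_square)
      finally show ?thesis .
    qed
    then show ?thesis by (auto simp: F_def)
  qed
  moreover have "\<not> F a \<subseteq> (\<Union>b\<in>B. F b)"
    if a: "a < n" and B: "B \<subseteq> {..<n}" "card B \<le> D" "a \<notin> B" for a B
  proof
    assume sub: "F a \<subseteq> (\<Union>b\<in>B. F b)"
    have finB: "finite B" using B(1) finite_subset by blast
    have "{..<t} \<subseteq> (\<Union>b\<in>B. {i. i < t \<and> w a i = w b i})"
    proof
      fix i assume "i \<in> {..<t}"
      then have i: "i < t" by simp
      then have "i * (2 * t) + w a i \<in> F a" by (auto simp: F_def)
      with sub obtain b k where b: "b \<in> B" "k < t" and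
        e: "i * (2 * t) + w a i = k * (2 * t) + w b k" by (auto simp: F_def)
      have "b < n" using b B by auto
      have "i = (i * (2 * t) + w a i) div (2 * t)" using wlt[OF a i] by simp
      also have "\<dots> = k" unfolding e using wlt[OF \<open>b < n\<close> b(2)] by simp
      finally have "i = k" .
      with e b i show "i \<in> (\<Union>b\<in>B. {i. i < t \<and> w a i = w b i})" by auto
    qed
    then have "card {..<t} \<le> card (\<Union>b\<in>B. {i. i < t \<and> w a i = w b i})"
      using finB by (intro card_mono) auto
    also have "\<dots> \<le> (\<Sum>b\<in>B. card {i. i < t \<and> w a i = w b i})" by (rule card_UN_le[OF finB])
    also have "\<dots> \<le> (\<Sum>b\<in>B. s - 1)"
    proof (rule sum_mono)
      fix b assume "b \<in> B"
      then have "card {i. i < t \<and> w a i = w b i} < s" using w' a B by blast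
      then show "card {i. i < t \<and> w a i = w b i} \<le> s - 1" by simp
    qed
    also have "\<dots> \<le> D * (s - 1)" using B(2) by simp
    also have "\<dots> < D * s" using assms by simp
    finally show False by (simp add: t_def)
  qed
  ultimately show ?thesis by blast
qed

section \<open>Colour reduction\<close>

text \<open>Together with \<open>m \<noteq> m'\<close> this is adjacency in the conflict graph on
  pairs \<open>(m, l)\<close> with \<open>l m = 0\<close>: a receiver that cannot tell
  \<open>l\<close> from \<open>l'\<close> must still tell the messages apart.\<close>

definition levels_close :: "(nat \<Rightarrow> nat) \<Rightarrow> (nat \<Rightarrow> nat) \<Rightarrow> bool" where
  "levels_close l l' \<longleftrightarrow> (\<forall>x. l x \<le> l' x + 1 \<and> l' x \<le> l x + 1)"

definition level_fun :: "nat \<Rightarrow> nat \<Rightarrow> nat \<Rightarrow> (nat \<Rightarrow> nat) \<Rightarrow> bool" where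
  "level_fun N d i l \<longleftrightarrow> {x. l x \<le> i} \<subseteq> {1..N} \<and> card {x. l x \<le> i} \<le> d"

text \<open>The parameter \<open>i\<close> counts the colour reduction rounds performed, each of which looks one level
  further.\<close>

definition proper_colouring ::
  "nat \<Rightarrow> nat \<Rightarrow> nat \<Rightarrow> nat \<Rightarrow> (nat \<Rightarrow> (nat \<Rightarrow> nat) \<Rightarrow> nat) \<Rightarrow> bool" where
  "proper_colouring N d i s c \<longleftrightarrow>
     (\<forall>m l. level_fun N d i l \<and> l m = 0 \<longrightarrow> c m l < 2 ^ s) \<and>
     (\<forall>m m' l l'. level_fun N d i l \<and> level_fun N d i l' \<and> levels_close l l' \<and>
        l m = 0 \<and> l' m' = 0 \<and> m \<noteq> m' \<longrightarrow> c m l \<noteq> c m' l')"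

text \<open>Points of level above \<open>Suc i\<close> in \<open>l\<close> have level at least
  \<open>Suc i\<close> in a neighbour, so truncation sends them all to \<open>Suc i\<close>. Each
  remaining point has at most three possible values.\<close>

lemma card_truncated_neighbours:
  assumes "finite {x. l x \<le> Suc i}"
  shows "finite {(\<lambda>x. min (l' x) (Suc i)) | l'. levels_close l l'}"
    and "card {(\<lambda>x. min (l' x) (Suc i)) | l'. levels_close l l'} \<le> 3 ^ card {x. l x \<le> Suc i}"
proof -
  let ?A = "{x. l x \<le> Suc i}"
  let ?G = "{(\<lambda>x. min (l' x) (Suc i)) | l'. levels_close l l'}"
  let ?h = "\<lambda>f x. if x \<in> ?A then min (f x) (Suc i) else Suc i"
  let ?P = "PiE ?A (\<lambda>x. {l x - 1..l x + 1})"
  have finP: "finite ?P" by (intro finite_PiE assms) auto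
  have sub: "?G \<subseteq> ?h ` ?P"
  proof
    fix g assume "g \<in> ?G"
    then obtain l' where g: "g = (\<lambda>x. min (l' x) (Suc i))" and n: "levels_close l l'" by auto
    have n': "l x \<le> l' x + 1" "l' x \<le> l x + 1" for x using n by (auto simp: levels_close_def)
    have "restrict l' ?A \<in> ?P" using n' by (auto simp: le_diff_conv)
    moreover have "g = ?h (restrict l' ?A)"
    proof
      fix x show "g x = ?h (restrict l' ?A) x" using n'(1)[of x] by (auto simp: g min_def)
    qed
    ultimately show "g \<in> ?h ` ?P" by blast
  qed
  then show "finite ?G" using finP finite_surj by blast
  have "card ?G \<le> card ?P" using sub finP by (rule surj_card_le[rotated])
  also have "\<dots> = (\<Prod>x\<in>?A. card {l x - 1..l x + 1})" by (rule card_PiE[OF assms])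
  also have "\<dots> \<le> (\<Prod>x\<in>?A. 3)" by (rule prod_mono) auto
  also have "\<dots> = 3 ^ card ?A" by simp
  finally show "card ?G \<le> 3 ^ card ?A" .
qed

text \<open>The new colour of \<open>(m, l)\<close> is an element of the set \<open>F\<close> of its
  old colour that lies in no set belonging to a neighbour's old colour. A neighbour's new colour
  lies in its own set, hence differs. Cover-freeness is applied with \<open>8 ^ d\<close> because at
  most \<open>d * 3 ^ d\<close> old colours occur among the neighbours.\<close>

lemma colour_reduction:
  assumes c: "proper_colouring N d i s c" and s: "1 \<le> s"
    and s': "2 * (8 ^ d)\<^sup>2 * s\<^sup>2 \<le> (2::nat) ^ s'"
  shows "\<exists>c'. proper_colouring N d (Suc i) s' c'"
proof -
  have c1: "c m l < 2 ^ s" if "level_fun N d i l" "l m = 0" for m l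
    using c that by (auto simp: proper_colouring_def)
  have c2: "c m l \<noteq> c m' l'" if "level_fun N d i l" "level_fun N d i l'" "levels_close l l'"
    "l m = 0" "l' m' = 0" "m \<noteq> m'" for m m' l l'
    using c that by (auto simp: proper_colouring_def)
  obtain F :: "nat \<Rightarrow> nat set" where
    F1: "\<And>a. a < 2 ^ s \<Longrightarrow> F a \<subseteq> {..<2 * (8 ^ d)\<^sup>2 * s\<^sup>2}" and
    F2: "\<And>a B. a < 2 ^ s \<Longrightarrow> B \<subseteq> {..<2 ^ s} \<Longrightarrow> card B \<le> 8 ^ d \<Longrightarrow> a \<notin> B \<Longrightarrow>
            \<not> F a \<subseteq> (\<Union>b\<in>B. F b)"
    using cover_free_family[OF s _ order_refl, of "8 ^ d"] by (metis one_le_power one_le_numeral)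
  \<comment> \<open>Truncation leaves only finitely many neighbours to distinguish and does not
    change which points have level at most \<open>i\<close>.\<close>
  define T where "T l = (\<lambda>x. min (l x) (Suc i))" for l :: "nat \<Rightarrow> nat"
  define B where "B m l = {c m' (T l') | m' l'. levels_close l l' \<and> l' m' = 0 \<and> m' \<noteq> m}" for m l
  define c' where "c' m l = (SOME y. y \<in> F (c m (T l)) - (\<Union>b\<in>B m l. F b))" for m l
  have T0: "T l m = 0 \<longleftrightarrow> l m = 0" for l m by (auto simp: T_def min_def)
  have Tle: "{x. T l x \<le> i} = {x. l x \<le> i}" for l by (auto simp: T_def min_def)
  have Tclose: "levels_close (T l) (T l')" if "levels_close l l'" for l l'
    unfolding levels_close_def
  proof
    fix x
    have "l x \<le> l' x + 1 \<and> l' x \<le> l x + 1" using that by (simp add: levels_close_def)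
    then show "T l x \<le> T l' x + 1 \<and> T l' x \<le> T l x + 1" unfolding T_def by linarith
  qed
  \<comment> \<open>The first \<open>i\<close> levels of a neighbour lie inside the first
    \<open>Suc i\<close> levels of \<open>l\<close>, so the bound \<open>d\<close> carries over.
    This is where a round consumes a level.\<close>
  have lev: "level_fun N d i (T l')" if "level_fun N d (Suc i) l" "levels_close l l'" for l l'
  proof -
    have "{x. l' x \<le> i} \<subseteq> {x. l x \<le> Suc i}"
      using that(2) by (auto simp: levels_close_def) (metis Suc_le_mono le_trans)
    moreover have "finite {x. l x \<le> Suc i}"
      using that(1) by (auto simp: level_fun_def intro: finite_subset)
    ultimately show ?thesis
      using that(1) card_mono[of "{x. l x \<le> Suc i}" "{x. l' x \<le> i}"]
      unfolding level_fun_def Tle by (meson le_trans subset_trans)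
  qed
  have refl: "levels_close l l" for l by (simp add: levels_close_def)
  have cardB: "card (B m l) \<le> 8 ^ d" if "level_fun N d (Suc i) l" for m l
  proof -
    let ?A = "{x. l x \<le> Suc i}"
    let ?G = "{T l' | l'. levels_close l l'}"
    have fin: "finite ?A" and d: "card ?A \<le> d"
      using that by (auto simp: level_fun_def intro: finite_subset)
    have G: "finite ?G" "card ?G \<le> 3 ^ card ?A"
      using card_truncated_neighbours[OF fin] by (simp_all add: T_def)
    have "B m l \<subseteq> (\<lambda>(m', g). c m' g) ` (?A \<times> ?G)"
    proof
      fix b assume "b \<in> B m l"
      then obtain m' l' where b: "b = c m' (T l')" "levels_close l l'" "l' m' = 0"
        by (auto simp: B_def)
      \<comment> \<open>The message of a neighbour has level at most 1 in \<open>l\<close>, so it is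
        one of the at most \<open>d\<close> points of \<open>?A\<close>.\<close>
      then have "l m' \<le> 1" by (auto simp: levels_close_def) (metis add_0)
      with b show "b \<in> (\<lambda>(m', g). c m' g) ` (?A \<times> ?G)" by (force simp: image_iff)
    qed
    then have "card (B m l) \<le> card (?A \<times> ?G)" using fin G(1) by (intro surj_card_le) auto
    also have "\<dots> \<le> d * 3 ^ d"
      unfolding card_cartesian_product using d G(2)
      by (intro mult_mono) (auto intro: order_trans power_increasing)
    also have "\<dots> \<le> 2 ^ d * 4 ^ d" by (intro mult_mono power_mono) (auto simp: less_imp_le)
    also have "\<dots> = 8 ^ d" by (simp flip: power_mult_distrib)
    finally show ?thesis .
  qed
  have c': "c' m l \<in> F (c m (T l)) - (\<Union>b\<in>B m l. F b)"
    if l: "level_fun N d (Suc i) l" and m: "l m = 0" for m l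
  proof -
    have "\<not> F (c m (T l)) \<subseteq> (\<Union>b\<in>B m l. F b)"
    proof (rule F2)
      show "c m (T l) < 2 ^ s" using c1 lev[OF l refl] m T0 by simp
      show "B m l \<subseteq> {..<2 ^ s}" using c1 lev[OF l] T0 by (auto simp: B_def)
      show "card (B m l) \<le> 8 ^ d" by (rule cardB[OF l])
      show "c m (T l) \<notin> B m l"
      proof
        assume "c m (T l) \<in> B m l"
        then obtain m' l' where "c m (T l) = c m' (T l')" "levels_close l l'" "l' m' = 0" "m' \<noteq> m"
          by (auto simp: B_def)
        with c2[of "T l" "T l'" m m'] lev[OF l refl] lev[OF l] Tclose T0 m show False by metis
      qed
    qed
    then have "\<exists>y. y \<in> F (c m (T l)) - (\<Union>b\<in>B m l. F b)" by auto
    then show ?thesis unfolding c'_def by (rule someI_ex)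
  qed
  have "proper_colouring N d (Suc i) s' c'"
    unfolding proper_colouring_def
  proof (intro conjI allI impI; elim conjE)
    fix m l assume l: "level_fun N d (Suc i) l" and m: "l m = 0"
    have "c m (T l) < 2 ^ s" using c1 lev[OF l refl] m T0 by simp
    from F1[OF this] c'[OF l m] s' show "c' m l < 2 ^ s'" by auto
  next
    fix m m' l l' assume l: "level_fun N d (Suc i) l" "l m = 0" "levels_close l l'"
      and l': "level_fun N d (Suc i) l'" "l' m' = 0" and ne: "m \<noteq> m'"
    have "c m' (T l') \<in> B m l" using l l' ne by (auto simp: B_def)
    with c'[OF l(1,2)] c'[OF l'] show "c' m l \<noteq> c' m' l'" by auto
  qed
  then show ?thesis by blast
qed

section \<open>Iterated logarithms and the colour length after all rounds\<close>

lemma ln_two_ge_half: "1 / 2 \<le> ln (2::real)"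
  using ln_le_minus_one[of "1 / 2 :: real"] by (simp add: ln_div)

text \<open>Ensures that the \<open>LEAST\<close> in \<open>log_star\<close> is attained. If all
  iterates exceeded 1, each would be at least 2 because its logarithm exceeds 1; as
  \<open>log 2 x \<le> x - 1\<close> from 2 on, each iteration would then decrease the value by at
  least 1.\<close>

lemma log_star_exists: "\<exists>i. ((log 2) ^^ i) (real N) \<le> 1"
proof (rule ccontr)
  assume "\<not> ?thesis"
  then have gt: "((log 2) ^^ i) (real N) > 1" for i by (simp add: not_le)
  have ge: "((log 2) ^^ i) (real N) \<ge> 2" for i
  proof -
    have "1 < log 2 (((log 2) ^^ i) (real N))" using gt[of "Suc i"] by simp
    then show ?thesis using gt[of i] by (simp add: less_log_iff)
  qed
  have log_le: "log 2 x \<le> x - 1" if "x \<ge> 2" for x :: real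
  proof -
    have "ln (x / 2) \<le> x / 2 - 1" using that by (intro ln_le_minus_one) auto
    then have "ln x \<le> ln 2 + (x / 2 - 1)" using that by (simp add: ln_div)
    then have "log 2 x \<le> 1 + (x / 2 - 1) / ln 2"
      by (simp add: log_def field_simps)
    also have "(x / 2 - 1) / ln 2 \<le> (x / 2 - 1) / (1 / 2)"
      using that ln_two_ge_half by (intro divide_left_mono) auto
    finally show ?thesis using that by simp
  qed
  have "((log 2) ^^ i) (real N) \<le> real N - real i" for i
  proof (induction i)
    case (Suc i)
    then show ?case using log_le[OF ge[of i]] by simp
  qed simp
  from this[of N] ge[of N] show False by simp
qed

text \<open>Clamping at 1 keeps the value usable as a factor in length bounds once the plain
  iterated logarithm drops below 1.\<close>

fun log_iter :: "nat \<Rightarrow> nat \<Rightarrow> real" where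
  "log_iter N 0 = real N"
| "log_iter N (Suc i) = max 1 (log 2 (log_iter N i))"

lemma log_iter_log_star:
  assumes "N \<ge> 2"
  shows "log_iter N (log_star N) = 1" and "1 \<le> log_star N"
proof -
  have gt: "((log 2) ^^ i) (real N) > 1" if "i < log_star N" for i
    using that not_less_Least unfolding log_star_def by (metis not_le)
  have le: "((log 2) ^^ log_star N) (real N) \<le> 1"
    unfolding log_star_def by (rule LeastI_ex[OF log_star_exists])
  show 1: "1 \<le> log_star N" using le assms by (cases "log_star N") auto
  have eq: "i \<le> log_star N \<Longrightarrow> log_iter N i = max 1 (((log 2) ^^ i) (real N))" for i
  proof (induction i)
    case (Suc i)
    then show ?case using gt[of i] by (simp add: max_def)
  qed (use assms in simp)
  show "log_iter N (log_star N) = 1" using eq[of "log_star N"] le by simp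
qed

text \<open>A small slope allows the logarithm of a coefficient to be absorbed by the coefficient
  itself. Beyond 8 this is \<open>ln y \<le> y - 1\<close> at \<open>y = x / 8\<close>, combined
  with \<open>ln 2 \<ge> 1 / 2\<close>.\<close>

lemma log_le_quarter:
  fixes x :: real
  assumes "x > 0"
  shows "log 2 x \<le> 3 + x / 4"
proof (cases "x \<le> 8")
  case True
  then have "log 2 x \<le> log 2 (2 ^ 3)" using assms by (subst log_le_cancel_iff) auto
  also have "\<dots> = 3" by (subst log_nat_power) auto
  finally show ?thesis using assms by simp
next
  case False
  have "ln (x / 2 ^ 3) \<le> x / 2 ^ 3 - 1" using assms by (intro ln_le_minus_one) auto
  then have "ln x \<le> 3 * ln 2 + (x / 8 - 1)" using assms by (simp add: ln_div ln_realpow[of 2 3, simplified])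
  then have "log 2 x \<le> 3 + (x / 8 - 1) / ln 2" by (simp add: log_def field_simps)
  also have "(x / 8 - 1) / ln 2 \<le> (x / 8 - 1) / (1 / 2)"
    using False ln_two_ge_half by (intro divide_left_mono) auto
  finally show ?thesis using False by simp
qed

lemma le_two_power_if_log_le:
  fixes n :: nat
  assumes "n \<ge> 1" "log 2 n \<le> real s"
  shows "n \<le> 2 ^ s"
proof -
  have "real n = 2 powr (log 2 n)" using assms by simp
  also have "\<dots> \<le> 2 powr real s" using assms by (intro powr_mono) auto
  also have "\<dots> = real (2 ^ s)" by (simp add: powr_realpow)
  finally show ?thesis by (simp only: of_nat_le_iff)
qed

text \<open>A round turns \<open>s\<close> bits into \<open>1 + 6 * d + 2 * log 2 s\<close>, rounded
  up. The coefficient \<open>A = 12 * d + 20\<close> solves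
  \<open>8 + 6 * d + A / 2 = A - 2\<close>, and the slack 2 pays for the term
  \<open>2 * log 2 M\<close>. The index of \<open>log_iter\<close> is one ahead of the rounds
  because \<open>s\<close> counts bits, not colours.\<close>

lemma proper_colouring_iterate:
  assumes N: "N \<ge> 2"
  shows "\<exists>s c. 1 \<le> s \<and> real s \<le> (12 * real d + 20) * log_iter N (Suc i) \<and> proper_colouring N d i s c"
proof (induction i)
  case 0
  \<comment> \<open>Before the first round the message is its own colour, written with
    \<open>s\<close> bits.\<close>
  define s where "s = nat \<lfloor>log 2 N\<rfloor> + 1"
  have l: "log 2 N \<ge> 1" using N by simp
  have "real s \<le> log 2 N + 1" using l by (simp add: s_def of_nat_nat)
  also have "\<dots> \<le> 20 * log_iter N 1" using l by simp
  also have "\<dots> \<le> (12 * real d + 20) * log_iter N 1" by (intro mult_right_mono) auto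
  finally have s1: "real s \<le> (12 * real d + 20) * log_iter N (Suc 0)" by simp
  have "log 2 N < real s" using l by (simp add: s_def of_nat_nat) linarith
  then have "real N < 2 powr s" using N by (simp add: log_less_iff)
  also have "2 powr s = real (2 ^ s)" by (simp add: powr_realpow)
  finally have s2: "N < 2 ^ s" by (simp only: of_nat_less_iff)
  have "m < 2 ^ s" if "level_fun N d 0 l" "l m = 0" for m l
  proof -
    have "m \<in> {1..N}" using that by (auto simp: level_fun_def)
    then show ?thesis using s2 by simp
  qed
  then have "proper_colouring N d 0 s (\<lambda>m l. m)" unfolding proper_colouring_def by blast
  with s1 show ?case by (intro exI[of _ s] exI[of _ "\<lambda>m l. m"]) (simp add: s_def)
next
  case (Suc i)
  then obtain s c where s: "1 \<le> s" "real s \<le> (12 * real d + 20) * log_iter N (Suc i)"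
    and c: "proper_colouring N d i s c" by blast
  define A where "A = 12 * real d + 20"
  define M where "M = log_iter N (Suc i)"
  define s' where "s' = nat \<lceil>1 + 6 * real d + 2 * log 2 s\<rceil>"
  have ls: "0 \<le> log 2 s" using s(1) by simp
  have M: "1 \<le> M" by (simp add: M_def)
  have M': "log_iter N (Suc (Suc i)) = max 1 (log 2 M)" by (simp add: M_def)
  have A: "A \<ge> 20" by (simp add: A_def)
  have "log 2 s \<le> log 2 (A * M)" using s A M by (simp add: A_def M_def)
  also have "\<dots> = log 2 A + log 2 M" using A M by (simp add: log_mult)
  also have "\<dots> \<le> 3 + A / 4 + log 2 M" using log_le_quarter[of A] A by simp
  finally have ls2: "log 2 s \<le> 3 + A / 4 + log 2 M" .
  have s'_ge: "1 + 6 * real d + 2 * log 2 s \<le> real s'" unfolding s'_def by (rule real_nat_ceiling_ge)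
  then have "1 \<le> real s'" using ls by linarith
  then have s'1: "1 \<le> s'" by simp
  have "real s' \<le> 2 + 6 * real d + 2 * log 2 s" using ls by (simp add: s'_def of_nat_nat) linarith
  also have "\<dots> \<le> 8 + 6 * real d + A / 2 + 2 * log 2 M" using ls2 by simp
  also have "\<dots> = (A - 2) + 2 * log 2 M" by (simp add: A_def)
  also have "\<dots> \<le> (A - 2) * max 1 (log 2 M) + 2 * max 1 (log 2 M)"
  proof (rule add_mono)
    have "(A - 2) * 1 \<le> (A - 2) * max 1 (log 2 M)" using A by (intro mult_left_mono) auto
    then show "A - 2 \<le> (A - 2) * max 1 (log 2 M)" by simp
  qed auto
  also have "\<dots> = A * log_iter N (Suc (Suc i))" by (simp only: M') (simp add: algebra_simps)
  finally have s'2: "real s' \<le> A * log_iter N (Suc (Suc i))" .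
  have "2 * (8 ^ d)\<^sup>2 * s\<^sup>2 \<le> (2::nat) ^ s'"
  proof (rule le_two_power_if_log_le)
    show "1 \<le> 2 * (8 ^ d)\<^sup>2 * s\<^sup>2" using s(1) by simp
    have "log 2 (real (8 ^ d)) = 3 * real d"
      using log_nat_power[of 2 2 "3 * d"] by (simp add: power_mult)
    then have "log 2 (real (2 * (8 ^ d)\<^sup>2 * s\<^sup>2)) = 1 + 6 * real d + 2 * log 2 s"
      using s(1) by (simp add: log_mult log_nat_power power_mult_distrib)
    then show "log 2 (real (2 * (8 ^ d)\<^sup>2 * s\<^sup>2)) \<le> real s'"
      using s'_ge by simp
  qed
  from colour_reduction[OF c s(1) this] s'1 s'2 show ?case by (auto simp: A_def)
qed

corollary proper_colouring_exists:
  assumes N: "N \<ge> 2"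
  shows "\<exists>s c. s \<le> 12 * d + 20 \<and> proper_colouring N d (log_star N) s c"
proof -
  have "log_iter N (Suc (log_star N)) = 1" using log_iter_log_star[OF N] by simp
  with proper_colouring_iterate[OF N, of d "log_star N"] obtain s c where
    "real s \<le> 12 * real d + 20" "proper_colouring N d (log_star N) s c" by auto
  moreover from this(1) have "s \<le> 12 * d + 20" by linarith
  ultimately show ?thesis by blast
qed

section \<open>Level sets of log-concave distributions\<close>

text \<open>By concavity the average descent over the first \<open>x\<close> steps is at most the
  next descent (fact \<open>step\<close>), so average descents never decrease; the inequality is
  stated free of denominators.\<close>

lemma concave_chord_slope:
  fixes g :: "nat \<Rightarrow> real"
  assumes conc: "\<And>k. k + 2 \<le> n \<Longrightarrow> g k + g (k + 2) \<le> 2 * g (k + 1)"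
    and r: "1 \<le> r" "r \<le> x" "x \<le> n"
  shows "real x * (g 0 - g r) \<le> real r * (g 0 - g x)"
proof -
  have step: "x + 1 \<le> n \<Longrightarrow> g 0 - g x \<le> real x * (g x - g (x + 1))" for x
  proof (induction x)
    case (Suc x)
    have "g 0 - g (Suc x) \<le> (real x + 1) * (g x - g (x + 1))"
      using Suc by (simp add: algebra_simps)
    also have "\<dots> \<le> (real x + 1) * (g (Suc x) - g (Suc x + 1))"
      using conc[of x] Suc.prems by (intro mult_left_mono) auto
    finally show ?case by (simp add: add.commute)
  qed simp
  show ?thesis using r(2,3)
  proof (induction x rule: dec_induct)
    case (step x)
    have x: "real x > 0" using step r by simp
    have "real x * (real (Suc x) * (g 0 - g r)) = real (Suc x) * (real x * (g 0 - g r))"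
      by (simp add: algebra_simps)
    also have "\<dots> \<le> real (Suc x) * (real r * (g 0 - g x))"
      using step by (intro mult_left_mono) auto
    also have "\<dots> = real x * (real r * (g 0 - g x)) + real r * (g 0 - g x)"
      by (simp add: algebra_simps)
    also have "\<dots> \<le> real x * (real r * (g 0 - g x)) + real r * (real x * (g x - g (x + 1)))"
      using \<open>\<And>x. x + 1 \<le> n \<Longrightarrow> g 0 - g x \<le> real x * (g x - g (x + 1))\<close>[of x] step
      by (intro add_left_mono mult_left_mono) auto
    also have "\<dots> = real x * (real r * (g 0 - g (Suc x)))" by (simp add: algebra_simps)
    finally show ?case using x by simp
  qed simp
qed

text \<open>Let \<open>r\<close> be the first index at which \<open>h\<close> is below
  \<open>h 0 / 2\<close>; the total mass forces \<open>r \<le> 2 / h 0\<close>. The logarithm of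
  \<open>h\<close> is concave and has fallen by at least 1 at \<open>r\<close>, so an index beyond
  \<open>r\<close> with a fall of at most \<open>u\<close> is at most \<open>r * u\<close>.\<close>

lemma log_concave_tail_level_set:
  fixes h :: "nat \<Rightarrow> real"
  assumes pos: "\<And>k. k \<le> n \<Longrightarrow> h k > 0"
    and lc: "\<And>k. k + 2 \<le> n \<Longrightarrow> h k * h (k + 2) \<le> (h (k + 1))\<^sup>2"
    and max: "\<And>k. k \<le> n \<Longrightarrow> h k \<le> h 0"
    and sum: "(\<Sum>k\<le>n. h k) \<le> 1" and u: "u \<ge> 0"
  shows "real (card {k \<in> {1..n}. h k \<ge> h 0 * 2 powr (- u)}) \<le> 2 * (1 + u) / h 0"
proof -
  let ?S = "{k \<in> {1..n}. h k \<ge> h 0 * 2 powr (- u)}"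
  have h0: "h 0 > 0" using pos by simp
  have half: "real r \<le> 2 / h 0" if "\<And>k. k < r \<Longrightarrow> k \<le> n \<and> h 0 / 2 \<le> h k" for r
  proof -
    have "real r * (h 0 / 2) = (\<Sum>k<r. h 0 / 2)" by simp
    also have "\<dots> \<le> (\<Sum>k<r. h k)" using that by (intro sum_mono) auto
    also have "\<dots> \<le> (\<Sum>k\<le>n. h k)" using that pos by (intro sum_mono2) (auto intro: less_imp_le)
    also have "\<dots> \<le> 1" by (rule sum)
    finally show ?thesis using h0 by (simp add: field_simps)
  qed
  show ?thesis
  proof (cases "\<forall>k\<le>n. h 0 / 2 \<le> h k")
    case True
    have "real (card ?S) \<le> real n"
      using card_mono[of "{1..n}" ?S] by (simp add: subset_iff)
    also have "\<dots> \<le> 2 / h 0" using half[of n] True by simp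
    also have "\<dots> \<le> 2 * (1 + u) / h 0" using u h0 by (intro divide_right_mono) auto
    finally show ?thesis .
  next
    case False
    define r where "r = (LEAST k. k \<le> n \<and> h k < h 0 / 2)"
    have ex: "\<exists>k. k \<le> n \<and> h k < h 0 / 2" using False by (auto simp: not_le)
    have r: "r \<le> n" "h r < h 0 / 2" using LeastI_ex[OF ex] unfolding r_def by auto
    have r_min: "h 0 / 2 \<le> h k" if "k < r" for k
      using not_less_Least[of k "\<lambda>k. k \<le> n \<and> h k < h 0 / 2"] that r(1) unfolding r_def by auto
    have r1: "1 \<le> r" using r(2) h0 by (cases r) auto
    have r2: "real r \<le> 2 / h 0" using half[of r] r_min r(1) by simp
    have gconc: "log 2 (h k) + log 2 (h (k + 2)) \<le> 2 * log 2 (h (k + 1))" if "k + 2 \<le> n" for k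
    proof -
      have p: "h k > 0" "h (k + 2) > 0" "h (k + 1) > 0" using pos that by auto
      have "log 2 (h k * h (k + 2)) \<le> log 2 ((h (k + 1))\<^sup>2)"
        using lc[OF that] p by (intro log_mono) auto
      then show ?thesis using p by (simp add: log_mult log_nat_power)
    qed
    have slope: "real k \<le> real r * (1 + u)" if k: "k \<in> ?S" for k
    proof (cases "k \<le> r")
      case True
      then have "real k \<le> real r * 1" by simp
      also have "\<dots> \<le> real r * (1 + u)" using u by (intro mult_left_mono) auto
      finally show ?thesis .
    next
      case False
      have hk: "h k > 0" "h r > 0" using k pos r by auto
      have "log 2 (h r) \<le> log 2 (h 0 / 2)" using r(2) hk by (intro log_mono) auto
      then have a: "1 \<le> log 2 (h 0) - log 2 (h r)" using h0 by (simp add: log_divide)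
      have "log 2 (h 0 * 2 powr (- u)) \<le> log 2 (h k)" using k h0 by (intro log_mono) auto
      then have b: "log 2 (h 0) - log 2 (h k) \<le> u" using h0 by (simp add: log_mult)
      have "real k * 1 \<le> real k * (log 2 (h 0) - log 2 (h r))" using a by (intro mult_left_mono) auto
      also have "\<dots> \<le> real r * (log 2 (h 0) - log 2 (h k))"
        using concave_chord_slope[of n "\<lambda>k. log 2 (h k)" r k] gconc r1 False k by auto
      also have "\<dots> \<le> real r * (1 + u)" using b by (intro mult_left_mono) auto
      finally show ?thesis by simp
    qed
    have "?S \<subseteq> {1..nat \<lfloor>real r * (1 + u)\<rfloor>}" using slope by (auto simp: le_nat_floor)
    then have "card ?S \<le> nat \<lfloor>real r * (1 + u)\<rfloor>"
      using card_mono[of "{1..nat \<lfloor>real r * (1 + u)\<rfloor>}" ?S] by simp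
    also have "real \<dots> \<le> real r * (1 + u)" using u by simp
    also have "\<dots> \<le> 2 / h 0 * (1 + u)" using r2 u by (intro mult_right_mono) auto
    finally show ?thesis by simp
  qed
qed

text \<open>Split at a mode \<open>a\<close>: the two tails contribute
  \<open>2 * (1 + u) / f a\<close> each, and \<open>a\<close> itself counts 1, which is at most
  \<open>(1 + u) / f a\<close>.\<close>

lemma log_concave_level_set:
  fixes f :: "nat \<Rightarrow> real"
  assumes pos: "\<And>k. k \<le> n \<Longrightarrow> f k > 0"
    and lc: "\<And>k. k + 2 \<le> n \<Longrightarrow> f k * f (k + 2) \<le> (f (k + 1))\<^sup>2"
    and sum: "(\<Sum>k\<le>n. f k) = 1"
  shows "\<exists>M. 0 < M \<and> M \<le> 1 \<and> (\<forall>k\<le>n. f k \<le> M) \<and>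
     (\<forall>u\<ge>0. real (card {k. k \<le> n \<and> f k \<ge> M * 2 powr (- u)}) \<le> 5 * (1 + u) / M)"
proof -
  obtain a where a: "a \<le> n" "\<And>k. k \<le> n \<Longrightarrow> f k \<le> f a"
    using Max_in[of "f ` {..n}"] Max_ge[of "f ` {..n}"] by fastforce
  have fa: "f a > 0" using pos a by simp
  have "f a \<le> (\<Sum>k\<le>n. f k)" using a pos by (intro member_le_sum) (auto intro: less_imp_le)
  then have fa1: "f a \<le> 1" using sum by simp
  have "real (card {k. k \<le> n \<and> f k \<ge> f a * 2 powr (- u)}) \<le> 5 * (1 + u) / f a" if u: "u \<ge> 0" for u
  proof -
    define R where "R = {k \<in> {1..n - a}. f (a + k) \<ge> f (a + 0) * 2 powr (- u)}"
    define L where "L = {k \<in> {1..a}. f (a - k) \<ge> f (a - 0) * 2 powr (- u)}"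
    have "(\<Sum>k\<le>n - a. f (a + k)) = sum f ((\<lambda>k. a + k) ` {..n - a})"
      by (subst sum.reindex) (auto simp: inj_on_def)
    also have "\<dots> \<le> (\<Sum>k\<le>n. f k)" using a pos by (intro sum_mono2) (auto intro: less_imp_le)
    finally have sR: "(\<Sum>k\<le>n - a. f (a + k)) \<le> 1" using sum by simp
    have "(\<Sum>k\<le>a. f (a - k)) = sum f ((\<lambda>k. a - k) ` {..a})"
      by (subst sum.reindex) (auto simp: inj_on_def)
    also have "\<dots> \<le> (\<Sum>k\<le>n. f k)" using a pos by (intro sum_mono2) (auto intro: less_imp_le)
    finally have sL: "(\<Sum>k\<le>a. f (a - k)) \<le> 1" using sum by simp
    have cR: "real (card R) \<le> 2 * (1 + u) / f (a + 0)" unfolding R_def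
    proof (rule log_concave_tail_level_set[where h = "\<lambda>k. f (a + k)"])
      show "f (a + k) * f (a + (k + 2)) \<le> (f (a + (k + 1)))\<^sup>2" if "k + 2 \<le> n - a" for k
        using lc[of "a + k"] that a by (simp add: add.assoc)
    qed (use a pos sR u in auto)
    have cL: "real (card L) \<le> 2 * (1 + u) / f (a - 0)" unfolding L_def
    proof (rule log_concave_tail_level_set[where h = "\<lambda>k. f (a - k)"])
      show "f (a - k) * f (a - (k + 2)) \<le> (f (a - (k + 1)))\<^sup>2" if "k + 2 \<le> a" for k
      proof -
        have "a - k = a - (k + 2) + 2" "a - (k + 1) = a - (k + 2) + 1" using that by auto
        then show ?thesis using lc[of "a - (k + 2)"] that a by (simp add: mult.commute)
      qed
    qed (use a pos sL u in auto)
    have fin: "finite R" "finite L" by (auto simp: R_def L_def)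
    have "{k. k \<le> n \<and> f k \<ge> f a * 2 powr (- u)} \<subseteq> insert a ((\<lambda>k. a + k) ` R \<union> (\<lambda>k. a - k) ` L)"
    proof
      fix k assume k: "k \<in> {k. k \<le> n \<and> f k \<ge> f a * 2 powr (- u)}"
      consider "k = a" | "k > a" | "k < a" by linarith
      then show "k \<in> insert a ((\<lambda>k. a + k) ` R \<union> (\<lambda>k. a - k) ` L)"
      proof cases
        case 2
        then have "k - a \<in> R" "k = a + (k - a)" using k by (auto simp: R_def)
        then show ?thesis by blast
      next
        case 3
        then have "a - k \<in> L" "k = a - (a - k)" using k by (auto simp: L_def)
        then show ?thesis by blast
      qed simp
    qed
    then have "card {k. k \<le> n \<and> f k \<ge> f a * 2 powr (- u)}
        \<le> card (insert a ((\<lambda>k. a + k) ` R \<union> (\<lambda>k. a - k) ` L))"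
      using fin by (intro card_mono) auto
    also have "\<dots> \<le> 1 + card ((\<lambda>k. a + k) ` R \<union> (\<lambda>k. a - k) ` L)" by (rule card_insert_le_m1) auto
    also have "\<dots> \<le> 1 + (card R + card L)"
      using card_Un_le[of "(\<lambda>k. a + k) ` R" "(\<lambda>k. a - k) ` L"]
        card_image_le[OF fin(1), of "\<lambda>k. a + k"] card_image_le[OF fin(2), of "\<lambda>k. a - k"] by linarith
    finally have "real (card {k. k \<le> n \<and> f k \<ge> f a * 2 powr (- u)}) \<le> 1 + (real (card R) + real (card L))"
      by linarith
    also have "\<dots> \<le> (1 + u) / f a + (2 * (1 + u) / f a + 2 * (1 + u) / f a)"
      using cR cL fa fa1 u by (intro add_mono) (auto simp: field_simps)
    also have "\<dots> = 5 * (1 + u) / f a" by (simp add: add_divide_distrib[symmetric])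
    finally show ?thesis .
  qed
  with a fa fa1 show ?thesis by blast
qed

text \<open>The interface between the families and the length bound in terms of \<open>M\<close>.
  For all three families the witness \<open>M\<close> is the maximum of \<open>P\<close>.\<close>

definition small_level_sets :: "nat \<Rightarrow> (nat \<Rightarrow> real) \<Rightarrow> real \<Rightarrow> bool" where
  "small_level_sets N P M \<longleftrightarrow> 0 < M \<and> M \<le> 1 \<and> (\<forall>m\<in>{1..N}. P m \<le> M) \<and>
     (\<forall>u\<ge>0. real (card {m \<in> {1..N}. P m \<ge> M * 2 powr (- u)}) \<le> 5 * (1 + u) / M)"

lemma log_concave_level_set_bij:
  fixes \<pi> :: "nat \<Rightarrow> nat"
  assumes dist: "is_dist N P" and bij: "bij_betw \<pi> {..n} {1..N}"
    and pos: "\<And>k. k \<le> n \<Longrightarrow> P (\<pi> k) > 0"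
    and lc: "\<And>k. k + 2 \<le> n \<Longrightarrow> P (\<pi> k) * P (\<pi> (k + 2)) \<le> (P (\<pi> (k + 1)))\<^sup>2"
  shows "\<exists>M. small_level_sets N P M"
proof -
  have "(\<Sum>k\<le>n. P (\<pi> k)) = (\<Sum>m=1..N. P m)" by (rule sum.reindex_bij_betw[OF bij])
  also have "\<dots> = 1" using dist by (simp add: is_dist_def)
  finally have "(\<Sum>k\<le>n. P (\<pi> k)) = 1" .
  from log_concave_level_set[of n "\<lambda>k. P (\<pi> k)", OF pos lc this]
  obtain M where M: "0 < M" "M \<le> 1" "\<And>k. k \<le> n \<Longrightarrow> P (\<pi> k) \<le> M" and
    c: "\<And>u. u \<ge> 0 \<Longrightarrow> real (card {k. k \<le> n \<and> P (\<pi> k) \<ge> M * 2 powr (- u)}) \<le> 5 * (1 + u) / M"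
    by blast
  have "card {m \<in> {1..N}. P m \<ge> M * 2 powr (- u)} = card {k. k \<le> n \<and> P (\<pi> k) \<ge> M * 2 powr (- u)}" for u
  proof -
    have "bij_betw \<pi> {k. k \<le> n \<and> P (\<pi> k) \<ge> M * 2 powr (- u)} {m \<in> {1..N}. P m \<ge> M * 2 powr (- u)}"
      using bij by (rule bij_betw_subset) (use bij in \<open>auto simp: bij_betw_def\<close>)
    then show ?thesis by (simp add: bij_betw_same_card)
  qed
  moreover have "P m \<le> M" if "m \<in> {1..N}" for m
  proof -
    have "m \<in> \<pi> ` {..n}" using that bij by (simp add: bij_betw_def)
    then obtain k where "k \<le> n" "m = \<pi> k" by auto
    then show ?thesis using M(3) by simp
  qed
  ultimately show ?thesis using M(1,2) c by (intro exI[of _ M]) (auto simp: small_level_sets_def)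
qed

section \<open>Level sets of the three families\<close>

lemma Flat_level_set:
  assumes "P \<in> Flat N"
  shows "\<exists>M. small_level_sets N P M"
proof -
  obtain S where S: "S \<subseteq> {1..N}" "S \<noteq> {}"
    and P: "\<And>m. m \<in> {1..N} \<Longrightarrow> P m = (if m \<in> S then 1 / real (card S) else 0)"
    using assms unfolding Flat_def by blast
  have fin: "finite S" using S(1) finite_subset by blast
  then have cS: "card S \<ge> 1" using S(2) by (simp add: Suc_le_eq card_gt_0_iff)
  define M where "M = 1 / real (card S)"
  have "real (card {m \<in> {1..N}. P m \<ge> M * 2 powr (- u)}) \<le> 5 * (1 + u) / M" if "u \<ge> 0" for u
  proof -
    \<comment> \<open>The threshold is positive, so the level set stays inside \<open>S\<close>
      however large \<open>u\<close> is.\<close>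
    have "0 < M * 2 powr (- u)" using cS by (simp add: M_def)
    then have "{m \<in> {1..N}. P m \<ge> M * 2 powr (- u)} \<subseteq> S" using P by (auto split: if_splits)
    then have "real (card {m \<in> {1..N}. P m \<ge> M * 2 powr (- u)}) \<le> 1 * real (card S)"
      using card_mono[OF fin] by simp
    also have "\<dots> \<le> (5 * (1 + u)) * real (card S)" using that by (intro mult_right_mono) auto
    finally show ?thesis by (simp add: M_def)
  qed
  then show ?thesis using cS P by (intro exI[of _ M]) (auto simp: small_level_sets_def M_def)
qed

lemma Geo_level_set:
  assumes "P \<in> Geo N" "N \<ge> 1"
  shows "\<exists>M. small_level_sets N P M"
proof -
  obtain \<alpha> \<pi> where \<alpha>: "0 < \<alpha>" "\<alpha> < 1" and bij: "bij_betw \<pi> {1..N} {1..N}"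
    and step: "\<And>k. k \<in> {1..N-1} \<Longrightarrow> P (\<pi> (k+1)) = \<alpha> * P (\<pi> k)" and dist: "is_dist N P"
    using assms by (auto simp: Geo_def)
  let ?\<sigma> = "\<lambda>k. \<pi> (k + 1)"
  have "bij_betw (\<lambda>k. k + 1) {..N - 1} {1..N}"
    by (rule bij_betw_byWitness[where f' = "\<lambda>k. k - 1"]) (use assms in auto)
  from bij_betw_trans[OF this bij] have bij': "bij_betw ?\<sigma> {..N - 1} {1..N}" by (simp add: o_def)
  have pow: "k \<le> N - 1 \<Longrightarrow> P (?\<sigma> k) = \<alpha> ^ k * P (\<pi> 1)" for k
  proof (induction k)
    case (Suc k)
    then show ?case using step[of "k + 1"] by simp
  qed simp
  \<comment> \<open>All weights are multiples of this one, so if it vanished the total mass would be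
    0.\<close>
  have P1: "P (\<pi> 1) > 0"
  proof (rule ccontr)
    assume "\<not> P (\<pi> 1) > 0"
    moreover have "\<pi> 1 \<in> {1..N}" using bij assms by (auto simp: bij_betw_def)
    ultimately have "P (\<pi> 1) = 0" using dist by (force simp: is_dist_def)
    then have "(\<Sum>k\<le>N - 1. P (?\<sigma> k)) = 0" using pow by simp
    moreover have "(\<Sum>k\<le>N - 1. P (?\<sigma> k)) = (\<Sum>m=1..N. P m)" by (rule sum.reindex_bij_betw[OF bij'])
    ultimately show False using dist by (simp add: is_dist_def)
  qed
  show ?thesis
  proof (rule log_concave_level_set_bij[OF dist bij'])
    show "P (?\<sigma> k) > 0" if "k \<le> N - 1" for k using pow[OF that] P1 \<alpha> by simp
    show "P (?\<sigma> k) * P (?\<sigma> (k + 2)) \<le> (P (?\<sigma> (k + 1)))\<^sup>2" if "k + 2 \<le> N - 1" for k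
      using pow[of k] pow[of "k + 1"] pow[of "k + 2"] that
      by (simp add: power2_eq_square algebra_simps)
  qed
qed

text \<open>The ratio \<open>(n - k) / (k + 1)\<close> of consecutive binomial coefficients
  decreases in \<open>k\<close>; facts \<open>a\<close> and \<open>b\<close> express it without
  division.\<close>

lemma binomial_log_concave:
  "(n choose k) * (n choose (k + 2)) \<le> (n choose (k + 1))\<^sup>2"
proof -
  have a: "(k + 1) * (n choose (k + 1)) = (n - k) * (n choose k)"
    using binomial_absorb_comp[of n k] binomial_absorption[of k n] by simp
  have b: "(k + 2) * (n choose (k + 2)) = (n - (k + 1)) * (n choose (k + 1))"
    using binomial_absorb_comp[of n "k + 1"] binomial_absorption[of "k + 1" n] by simp
  show ?thesis
  proof (cases "k < n")
    case True
    have "((k + 2) * (n - k)) * ((n choose k) * (n choose (k + 2)))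
        = ((n - k) * (n choose k)) * ((k + 2) * (n choose (k + 2)))" by (simp only: mult_ac)
    also have "\<dots> = ((k + 1) * (n - (k + 1))) * (n choose (k + 1))\<^sup>2"
      unfolding a[symmetric] b by (simp only: mult_ac power2_eq_square)
    also have "\<dots> \<le> ((k + 2) * (n - k)) * (n choose (k + 1))\<^sup>2"
      by (intro mult_right_mono mult_mono) auto
    finally show ?thesis using True by simp
  qed (simp add: binomial_eq_0)
qed

lemma Bin_level_set:
  assumes "P \<in> Bin N" "N \<ge> 1"
  shows "\<exists>M. small_level_sets N P M"
proof -
  obtain p \<pi> where p: "0 < p" "p < 1" and bij: "bij_betw \<pi> {0..N-1} {1..N}"
    and P: "\<And>k. k \<le> N - 1 \<Longrightarrow> P (\<pi> k) = real ((N-1) choose k) * p ^ k * (1-p) ^ (N-1-k)"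
    and dist: "is_dist N P"
    using assms by (auto simp: Bin_def)
  show ?thesis
  proof (rule log_concave_level_set_bij[OF dist])
    show "bij_betw \<pi> {..N - 1} {1..N}" using bij by (simp add: atLeast0AtMost)
    show "P (\<pi> k) > 0" if "k \<le> N - 1" for k using P[OF that] p that by simp
    show "P (\<pi> k) * P (\<pi> (k + 2)) \<le> (P (\<pi> (k + 1)))\<^sup>2" if k: "k + 2 \<le> N - 1" for k
    proof -
      \<comment> \<open>Naming \<open>j\<close> removes the subtraction in the exponents. Both sides
        then share the factor \<open>?w\<close>, and only the binomial coefficients have to be
        compared.\<close>
      obtain j where j: "N - 1 = k + 2 + j" using k le_Suc_ex by blast
      let ?b = "\<lambda>i. real ((N - 1) choose i)"
      let ?w = "(p ^ (k + 1) * (1 - p) ^ (j + 1))\<^sup>2"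
      have P': "P (\<pi> k) = ?b k * p ^ k * (1 - p) ^ (j + 2)"
        "P (\<pi> (k + 1)) = ?b (k + 1) * p ^ (k + 1) * (1 - p) ^ (j + 1)"
        "P (\<pi> (k + 2)) = ?b (k + 2) * p ^ (k + 2) * (1 - p) ^ j"
        using P[of k] P[of "k + 1"] P[of "k + 2"] unfolding j by auto
      have "?b k * ?b (k + 2) \<le> (?b (k + 1))\<^sup>2"
        using binomial_log_concave[of "N - 1" k]
        by (simp only: of_nat_mult[symmetric] of_nat_power[symmetric] of_nat_le_iff)
      then have "?b k * ?b (k + 2) * ?w \<le> (?b (k + 1))\<^sup>2 * ?w" by (intro mult_right_mono) auto
      moreover have "P (\<pi> k) * P (\<pi> (k + 2)) = ?b k * ?b (k + 2) * ?w"
        unfolding P' by (simp only: power2_eq_square power_add power_one_right mult_ac)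
      moreover have "(P (\<pi> (k + 1)))\<^sup>2 = (?b (k + 1))\<^sup>2 * ?w"
        unfolding P' by (simp only: power_mult_distrib mult_ac)
      ultimately show ?thesis by simp
    qed
  qed
qed

lemma Fam_level_set:
  assumes "P \<in> Fam N" "N \<ge> 1"
  shows "\<exists>M. small_level_sets N P M"
  using assms Flat_level_set Geo_level_set Bin_level_set unfolding Fam_def by blast

lemma Fam_is_dist: "P \<in> Fam N \<Longrightarrow> is_dist N P"
  by (auto simp: Fam_def Flat_def Geo_def Bin_def)

section \<open>Entropy and expected excess\<close>

lemma sum_support:
  assumes "is_dist N P"
  shows "(\<Sum>m\<in>{m \<in> {1..N}. P m > 0}. P m) = 1"
proof -
  have "(\<Sum>m\<in>{m \<in> {1..N}. P m > 0}. P m) = (\<Sum>m=1..N. P m)"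
    by (rule sum.mono_neutral_left) (use assms in \<open>auto simp: is_dist_def\<close>)
  then show ?thesis using assms by (simp add: is_dist_def)
qed

text \<open>Min-entropy is at most Shannon entropy: every surprisal on the support is at least
  \<open>log 2 (1 / M)\<close>, hence so is their average.\<close>

lemma inverse_max_le_two_powr_entropy:
  assumes P: "is_dist N P" and M: "0 < M" "\<And>m. m \<in> {1..N} \<Longrightarrow> P m \<le> M"
  shows "1 / M \<le> 2 powr entropy N P"
proof -
  let ?S = "{m \<in> {1..N}. P m > 0}"
  have "log 2 (1 / M) = (\<Sum>m\<in>?S. P m * log 2 (1 / M))"
    using sum_support[OF P] by (simp only: sum_distrib_right[symmetric] mult_1)
  also have "\<dots> \<le> entropy N P"
    unfolding entropy_def using M by (intro sum_mono mult_left_mono log_mono divide_left_mono) auto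
  finally have "2 powr (log 2 (1 / M)) \<le> 2 powr entropy N P" by (intro powr_mono) auto
  then show ?thesis using M(1) by simp
qed

text \<open>Twice the sum over all \<open>i\<close> of \<open>(i + 1) * r ^ i\<close> at
  \<open>r = 2 powr (- 1 / 4)\<close>.\<close>

definition layer_const :: real where
  "layer_const = 2 / (1 - 2 powr (- 1 / 4))\<^sup>2"

text \<open>Group the points by the integer part \<open>i\<close> of \<open>t\<close>. A layer has
  at most \<open>c * (i + 2)\<close>, hence at most \<open>2 * c * (i + 1)\<close>, points of weight
  at most \<open>r ^ i\<close> each, and the differentiated geometric series converges.\<close>

lemma sum_over_layers:
  fixes t :: "'a \<Rightarrow> real"
  assumes fin: "finite A" and t: "\<And>x. x \<in> A \<Longrightarrow> 0 \<le> t x" and c: "0 \<le> c"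
    and card: "\<And>u. 0 \<le> u \<Longrightarrow> real (card {x \<in> A. t x \<le> u}) \<le> c * (1 + u)"
  shows "(\<Sum>x\<in>A. 2 powr (- t x / 4)) \<le> c * layer_const"
proof -
  define r :: real where "r = 2 powr (- 1 / 4)"
  have "r < 2 powr 0" unfolding r_def by (rule powr_less_mono) auto
  then have r: "0 < r" "r < 1" by (auto simp: r_def)
  define k where "k x = nat \<lfloor>t x\<rfloor>" for x
  have "(\<Sum>x\<in>A. 2 powr (- t x / 4)) \<le> (\<Sum>x\<in>A. r ^ k x)"
  proof (rule sum_mono)
    fix x assume x: "x \<in> A"
    have "2 powr (- t x / 4) \<le> 2 powr (- 1 / 4 * real (k x))"
      using t[OF x] by (intro powr_mono) (auto simp: k_def)
    also have "\<dots> = r powr real (k x)" by (simp add: r_def powr_powr)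
    also have "\<dots> = r ^ k x" using r by (simp add: powr_realpow)
    finally show "2 powr (- t x / 4) \<le> r ^ k x" .
  qed
  also have "\<dots> = (\<Sum>i\<in>k ` A. \<Sum>x\<in>{x \<in> A. k x = i}. r ^ k x)"
    by (rule sum.image_gen[OF fin])
  also have "\<dots> = (\<Sum>i\<in>k ` A. real (card {x \<in> A. k x = i}) * r ^ i)" by (intro sum.cong) auto
  also have "\<dots> \<le> (\<Sum>i\<in>k ` A. 2 * c * (real (Suc i) * r ^ i))"
  proof (rule sum_mono)
    fix i
    have "{x \<in> A. k x = i} \<subseteq> {x \<in> A. t x \<le> real i + 1}"
    proof
      fix x assume x: "x \<in> {x \<in> A. k x = i}"
      then have "real i = of_int \<lfloor>t x\<rfloor>" using t[of x] by (auto simp: k_def)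
      then have "t x \<le> real i + 1" by linarith
      then show "x \<in> {x \<in> A. t x \<le> real i + 1}" using x by simp
    qed
    then have "card {x \<in> A. k x = i} \<le> card {x \<in> A. t x \<le> real i + 1}"
      using fin by (intro card_mono) auto
    then have "real (card {x \<in> A. k x = i}) \<le> c * (1 + (real i + 1))"
      using card[of "real i + 1"] by simp
    also have "\<dots> \<le> c * (2 * real (Suc i))" using c by (intro mult_left_mono) auto
    finally have "real (card {x \<in> A. k x = i}) * r ^ i \<le> c * (2 * real (Suc i)) * r ^ i"
      using r by (intro mult_right_mono) auto
    then show "real (card {x \<in> A. k x = i}) * r ^ i \<le> 2 * c * (real (Suc i) * r ^ i)"
      by (simp only: mult_ac)
  qed
  also have "\<dots> = 2 * c * (\<Sum>i\<in>k ` A. real (Suc i) * r ^ i)" by (simp only: sum_distrib_left)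
  also have "\<dots> \<le> 2 * c * (1 / (1 - r)\<^sup>2)"
  proof (rule mult_left_mono)
    have s: "(\<lambda>i. real (Suc i) * r ^ i) sums (1 / (1 - r)\<^sup>2)"
      using geometric_deriv_sums[of r] r by simp
    have "(\<Sum>i\<in>k ` A. real (Suc i) * r ^ i) \<le> (\<Sum>i. real (Suc i) * r ^ i)"
      using fin r by (intro sum_le_suminf sums_summable[OF s]) auto
    then show "(\<Sum>i\<in>k ` A. real (Suc i) * r ^ i) \<le> 1 / (1 - r)\<^sup>2" using sums_unique[OF s] by simp
  qed (use c in simp)
  finally show ?thesis unfolding layer_const_def r_def by (simp add: mult.commute)
qed

text \<open>Here \<open>20 = 4 * 5\<close>, with \<open>4 / ln 2\<close> from
  \<open>t \<le> 4 / ln 2 * 2 powr (t / 4)\<close> and 5 from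
  \<open>small_level_sets\<close>.\<close>

definition excess_const :: real where
  "excess_const = 20 / ln 2 * layer_const"

lemma excess_const_nonneg: "0 \<le> excess_const"
  by (simp add: excess_const_def layer_const_def)

text \<open>Where the excess \<open>t = log (M / Pt m)\<close> exceeds \<open>2 W\<close>, the density of \<open>P\<close> is at most
  \<open>M * 2 powr (- t / 2)\<close>, so these messages contribute only a constant.\<close>

lemma expected_excess:
  assumes P: "is_dist N P" and Pt: "small_level_sets N Pt M"
    and close: "\<And>m. m \<in> {1..N} \<Longrightarrow> P m \<le> 2 powr W * Pt m" and W: "W \<ge> 0"
  shows "(\<Sum>m\<in>{m\<in>{1..N}. P m > 0}. P m * log 2 (M / Pt m)) \<le> 2 * W + excess_const"
proof -
  let ?S = "{m\<in>{1..N}. P m > 0}"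
  define t where "t m = log 2 (M / Pt m)" for m
  have M: "0 < M" "\<And>m. m \<in> {1..N} \<Longrightarrow> Pt m \<le> M"
    "\<And>u. u \<ge> 0 \<Longrightarrow> real (card {m \<in> {1..N}. Pt m \<ge> M * 2 powr (- u)}) \<le> 5 * (1 + u) / M"
    using Pt by (auto simp: small_level_sets_def)
  have pos: "Pt m > 0" if "m \<in> ?S" for m
  proof -
    have "0 < 2 powr W * Pt m" using close[of m] that by auto
    then show ?thesis by (simp add: zero_less_mult_iff)
  qed
  have t0: "0 \<le> t m" if "m \<in> ?S" for m
    using pos[OF that] M(2)[of m] that by (simp add: t_def zero_le_log_cancel_iff)
  have Pt_eq: "Pt m = M * 2 powr (- t m)" if "m \<in> ?S" for m
    using pos[OF that] M(1) by (simp add: t_def powr_minus)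
  have sum1: "(\<Sum>m\<in>?S. P m) = 1" by (rule sum_support[OF P])
  have layers: "(\<Sum>m\<in>?S. 2 powr (- t m / 4)) \<le> 5 / M * layer_const"
  proof (rule sum_over_layers)
    show "real (card {m \<in> ?S. t m \<le> u}) \<le> 5 / M * (1 + u)" if u: "0 \<le> u" for u
    proof -
      have "{m \<in> ?S. t m \<le> u} \<subseteq> {m \<in> {1..N}. Pt m \<ge> M * 2 powr (- u)}"
        using Pt_eq M(1) by auto
      then have "card {m \<in> ?S. t m \<le> u} \<le> card {m \<in> {1..N}. Pt m \<ge> M * 2 powr (- u)}"
        by (intro card_mono) auto
      then show ?thesis using M(3)[OF u] by simp
    qed
  qed (use t0 M(1) in auto)
  have pointwise: "P m * t m \<le> 2 * W * P m + M * (4 / ln 2) * 2 powr (- t m / 4)" if m: "m \<in> ?S" for m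
  proof (cases "t m \<le> 2 * W")
    case True
    then have "P m * t m \<le> P m * (2 * W)" using m by (intro mult_left_mono) auto
    moreover have "0 \<le> M * (4 / ln 2) * 2 powr (- t m / 4)" using M(1) by simp
    ultimately show ?thesis by (simp add: mult.commute)
  next
    case False
    \<comment> \<open>An exponential of rate 1/4 swallows the factor \<open>t m\<close>; against the
      decay \<open>2 powr (- t m / 2)\<close> it leaves \<open>2 powr (- t m / 4)\<close>, which is
      summed by layers.\<close>
    have "1 + t m / 4 * ln 2 \<le> exp (t m / 4 * ln 2)" by (rule exp_ge_add_one_self)
    also have "\<dots> = 2 powr (t m / 4)" by (simp add: powr_def)
    finally have t4: "t m \<le> 4 / ln 2 * 2 powr (t m / 4)" by (simp add: field_simps)
    have "P m \<le> 2 powr W * (M * 2 powr (- t m))" using close[of m] m Pt_eq[OF m] by simp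
    also have "\<dots> = M * 2 powr (W - t m)" by (simp add: powr_diff powr_minus field_simps)
    also have "\<dots> \<le> M * 2 powr (- t m / 2)"
      using False M(1) by (intro mult_left_mono powr_mono) auto
    finally have "P m * t m \<le> (M * 2 powr (- t m / 2)) * (4 / ln 2 * 2 powr (t m / 4))"
      using t4 t0[OF m] m M(1) by (intro mult_mono) auto
    also have "\<dots> = M * (4 / ln 2) * (2 powr (- t m / 2) * 2 powr (t m / 4))" by (simp only: mult_ac)
    also have "2 powr (- t m / 2) * 2 powr (t m / 4) = 2 powr (- t m / 4)"
      by (simp flip: powr_add)
    finally have "P m * t m \<le> M * (4 / ln 2) * 2 powr (- t m / 4)" .
    moreover have "0 \<le> 2 * W * P m" using W m by simp
    ultimately show ?thesis by linarith
  qed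
  have "(\<Sum>m\<in>?S. P m * t m) \<le> (\<Sum>m\<in>?S. 2 * W * P m + M * (4 / ln 2) * 2 powr (- t m / 4))"
    using pointwise by (rule sum_mono)
  also have "\<dots> = 2 * W * (\<Sum>m\<in>?S. P m) + M * (4 / ln 2) * (\<Sum>m\<in>?S. 2 powr (- t m / 4))"
    by (simp only: sum.distrib sum_distrib_left)
  also have "\<dots> \<le> 2 * W * 1 + M * (4 / ln 2) * (5 / M * layer_const)"
    using layers sum1 M(1) W by (intro add_mono mult_left_mono) auto
  also have "\<dots> = 2 * W + excess_const" using M(1) by (simp add: excess_const_def)
  finally show ?thesis by (simp add: t_def)
qed

section \<open>The coding scheme\<close>

lemma bool_list_numbering:
  "\<exists>b :: nat \<Rightarrow> nat \<Rightarrow> bool list. \<forall>s. inj_on (b s) {..<2 ^ s} \<and> (\<forall>x<2 ^ s. length (b s x) = s)"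
proof -
  have "\<exists>b :: nat \<Rightarrow> bool list. inj_on b {..<2 ^ s} \<and> (\<forall>x<2 ^ s. length (b x) = s)" for s
  proof -
    have "card {xs :: bool list. length xs = s} = 2 ^ s"
      using card_lists_length_eq[of "UNIV :: bool set" s] by simp
    moreover have "finite {xs :: bool list. length xs = s}"
      using finite_lists_length_eq[of "UNIV :: bool set" s] by simp
    ultimately obtain b where "bij_betw b {..<2 ^ s :: nat} {xs :: bool list. length xs = s}"
      using finite_same_card_bij[of "{..<2 ^ s :: nat}" "{xs :: bool list. length xs = s}"] by auto
    then have "inj_on b {..<2 ^ s}" "b ` {..<2 ^ s} = {xs. length xs = s}"
      by (auto simp: bij_betw_def)
    then show ?thesis by (intro exI[of _ b]) blast
  qed
  then have "\<forall>s. \<exists>b :: nat \<Rightarrow> bool list. inj_on b {..<2 ^ s} \<and> (\<forall>x<2 ^ s. length (b x) = s)" ..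
  then show ?thesis by (rule choice)
qed

text \<open>Unary headers are self-delimiting, which lets the two counts and the colour be
  concatenated.\<close>

lemma unary_prefix_inject:
  "replicate j True @ False # xs = replicate k True @ False # ys \<longleftrightarrow> j = k \<and> xs = ys"
proof (induction j arbitrary: k)
  case 0
  show ?case by (cases k) auto
next
  case (Suc j)
  then show ?case by (cases k) auto
qed

text \<open>\<open>T\<close> is a threshold for \<open>log 2 (1 / P x)\<close>: below it
  \<open>nat\<close> sends the nonpositive ceiling to 0. The width \<open>2 * \<Delta>\<close> is
  the largest gap in log scale between two distributions close to a common one. The default
  \<open>Suc K\<close> keeps points of probability zero out of the levels up to
  \<open>K\<close>.\<close>

definition level_of :: "nat \<Rightarrow> nat \<Rightarrow> real \<Rightarrow> real \<Rightarrow> (nat \<Rightarrow> real) \<Rightarrow> nat \<Rightarrow> nat" where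
  "level_of N K \<Delta> T P x =
     (if x \<in> {1..N} \<and> P x > 0 then nat \<lceil>(log 2 (1 / P x) - T) / (2 * \<Delta>)\<rceil> else Suc K)"

lemma close_pos_iff:
  assumes "close N \<Delta> P Q" "m \<in> {1..N}"
  shows "P m > 0 \<longleftrightarrow> Q m > 0"
proof -
  have "P m \<le> 2 powr \<Delta> * Q m" "Q m \<le> 2 powr \<Delta> * P m" using assms by (auto simp: close_def)
  then show ?thesis by (smt (verit) powr_gt_zero zero_less_mult_iff)
qed

lemma close_log:
  assumes "close N \<Delta> P Q" "m \<in> {1..N}" "P m > 0"
  shows "\<bar>log 2 (1 / P m) - log 2 (1 / Q m)\<bar> \<le> \<Delta>"
proof -
  have Q: "Q m > 0" using close_pos_iff assms by blast
  have "P m \<le> 2 powr \<Delta> * Q m" "Q m \<le> 2 powr \<Delta> * P m" using assms by (auto simp: close_def)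
  then have "log 2 (P m) \<le> log 2 (2 powr \<Delta> * Q m)" "log 2 (Q m) \<le> log 2 (2 powr \<Delta> * P m)"
    using Q assms(3) by (auto intro: log_mono)
  then show ?thesis using Q assms(3) by (simp add: log_mult log_divide abs_le_iff)
qed

text \<open>By the triangle inequality through \<open>Q\<close> the logarithms differ by at most one
  layer width, so the arguments of the ceilings differ by at most 1. Positivity also passes through
  \<open>Q\<close>, so the default value occurs for both distributions at once.\<close>

lemma levels_close_level_of:
  assumes "close N \<Delta> P Q" "close N \<Delta> P' Q" "\<Delta> > 0"
  shows "levels_close (level_of N K \<Delta> T P) (level_of N K \<Delta> T P')"
  unfolding levels_close_def
proof
  fix x
  let ?l = "level_of N K \<Delta> T"
  show "?l P x \<le> ?l P' x + 1 \<and> ?l P' x \<le> ?l P x + 1"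
  proof (cases "x \<in> {1..N} \<and> P x > 0")
    case True
    then have "P' x > 0" using close_pos_iff assms by blast
    let ?a = "(log 2 (1 / P x) - T) / (2 * \<Delta>)" and ?b = "(log 2 (1 / P' x) - T) / (2 * \<Delta>)"
    have "\<bar>log 2 (1 / P x) - log 2 (1 / P' x)\<bar> \<le> 2 * \<Delta>"
      using close_log[OF assms(1), of x] close_log[OF assms(2), of x] True \<open>P' x > 0\<close> by auto
    moreover have "?a - ?b = (log 2 (1 / P x) - log 2 (1 / P' x)) / (2 * \<Delta>)"
      by (simp add: diff_divide_distrib)
    ultimately have "\<bar>?a - ?b\<bar> \<le> 1" using assms(3) by (simp add: abs_divide)
    then have "\<lceil>?a\<rceil> \<le> \<lceil>?b\<rceil> + 1 \<and> \<lceil>?b\<rceil> \<le> \<lceil>?a\<rceil> + 1" by linarith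
    moreover have "?l P x = nat \<lceil>?a\<rceil>" "?l P' x = nat \<lceil>?b\<rceil>"
      using True \<open>P' x > 0\<close> by (simp_all add: level_of_def)
    ultimately show ?thesis by linarith
  next
    case False
    then have "\<not> (x \<in> {1..N} \<and> P' x > 0)" using close_pos_iff assms by blast
    with False show ?thesis unfolding level_of_def by (simp only: if_False) simp
  qed
qed

text \<open>The decoder returns a message that some distribution close to \<open>Q\<close> would
  encode as \<open>w\<close>; \<open>sep\<close> makes this message unique.\<close>

lemma decoder_exists:
  assumes "N \<ge> 1"
    and sep: "\<And>P P' Q m m'. \<lbrakk>is_dist N P; is_dist N P'; close N \<Delta> P Q; close N \<Delta> P' Q;
       m \<in> {1..N}; m' \<in> {1..N}; E P m = E P' m'\<rbrakk> \<Longrightarrow> m = m'"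
  shows "\<exists>D. (\<forall>Q w. D Q w \<in> {1..N}) \<and>
    (\<forall>P Q m. is_dist N P \<and> close N \<Delta> P Q \<and> m \<in> {1..N} \<longrightarrow> D Q (E P m) = m)"
proof -
  define R where "R Q w m \<longleftrightarrow> m \<in> {1..N} \<and> (\<exists>P. is_dist N P \<and> close N \<Delta> P Q \<and> E P m = w)" for Q w m
  \<comment> \<open>The value 1 on words that no distribution close to \<open>Q\<close> produces
    merely keeps \<open>D\<close> inside \<open>{1..N}\<close>.\<close>
  define D where "D Q w = (if \<exists>m. R Q w m then SOME m. R Q w m else 1)" for Q w
  have "D Q w \<in> {1..N}" for Q w
  proof (cases "\<exists>m. R Q w m")
    case True
    then have "R Q w (D Q w)" unfolding D_def by (simp add: someI_ex)
    then show ?thesis by (simp add: R_def)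
  qed (use assms(1) in \<open>simp add: D_def\<close>)
  moreover have "D Q (E P m) = m" if "is_dist N P" "close N \<Delta> P Q" "m \<in> {1..N}" for P Q m
  proof -
    have "R Q (E P m) m" using that by (auto simp: R_def)
    then have "R Q (E P m) (D Q (E P m))" unfolding D_def by (auto intro: someI)
    then obtain P' where "is_dist N P'" "close N \<Delta> P' Q" "E P' (D Q (E P m)) = E P m"
      "D Q (E P m) \<in> {1..N}" by (auto simp: R_def)
    with sep[of P' P Q "D Q (E P m)" m] that show ?thesis by auto
  qed
  ultimately show ?thesis by blast
qed

text \<open>Each inspected point costs 13 bits: 1 in the unary count and 12 in the colour. The 24
  collects 3 marker bits, 20 colour bits and the rounding of \<open>J\<close>. In
  \<open>3 * W\<close>, rounding \<open>J\<close> accounts for at most \<open>W\<close>, and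
  \<open>K\<close> levels of width \<open>2 * \<Delta>\<close> span at most
  \<open>2 * W\<close>.\<close>

lemma scheme_exists:
  assumes N: "N \<ge> 2" and \<Delta>: "\<Delta> > 0" and W: "W \<ge> 1" "\<Delta> * real (log_star N) \<le> W"
  shows "\<exists>(E :: (nat \<Rightarrow> real) \<Rightarrow> nat \<Rightarrow> bool list) D. (\<forall>Q w. D Q w \<in> {1..N}) \<and>
    (\<forall>P Q m. is_dist N P \<and> close N \<Delta> P Q \<and> m \<in> {1..N} \<longrightarrow> D Q (E P m) = m) \<and>
    (\<forall>P m. is_dist N P \<and> m \<in> {1..N} \<and> P m > 0 \<longrightarrow>
       real (length (E P m)) \<le> log 2 (1 / P m) / W + 24 +
          13 * real (card {x \<in> {1..N}. P x \<ge> P m * 2 powr (- 3 * W)}))"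
proof -
  define K where "K = log_star N"
  define col where "col d = (\<lambda>(s, c). s \<le> 12 * d + 20 \<and> proper_colouring N d K s c)" for d
  have "\<forall>d. \<exists>sc. col d sc" using proper_colouring_exists[OF N] by (auto simp: col_def K_def)
  then obtain sc where sc: "\<And>d. col d (sc d)" by (metis (no_types))
  define ss cc where "ss d = fst (sc d)" and "cc d = snd (sc d)" for d
  have ss: "ss d \<le> 12 * d + 20" and cc: "proper_colouring N d K (ss d) (cc d)" for d
    using sc[of d] by (auto simp: col_def ss_def cc_def split: prod.splits)
  obtain b :: "nat \<Rightarrow> nat \<Rightarrow> bool list" where
    b: "\<And>s. inj_on (b s) {..<2 ^ s}" "\<And>s x. x < 2 ^ s \<Longrightarrow> length (b s x) = s"
    using bool_list_numbering by blast
  define J where "J P m = nat \<lceil>log 2 (1 / P m) / W\<rceil>" for P :: "nat \<Rightarrow> real" and m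
  define l where "l P j = level_of N K \<Delta> (W * real j) P" for P j
  define d where "d P j = card {x. l P j x \<le> K}" for P j
  \<comment> \<open>The first bit separates messages of positive probability from the others. The
    latter are sent in unary, which is free because they have weight 0 in the expectation.\<close>
  define E where "E P m = (if P m > 0 then True # replicate (J P m) True @ False #
      replicate (d P (J P m)) True @ False #
      b (ss (d P (J P m))) (cc (d P (J P m)) m (l P (J P m)))
    else False # replicate m True)" for P m
  have log_nonneg: "0 \<le> log 2 (1 / P m)" if "is_dist N P" "m \<in> {1..N}" "P m > 0" for P m
  proof -
    have "P m \<le> (\<Sum>m=1..N. P m)" using that by (intro member_le_sum) (auto simp: is_dist_def)
    then have "P m \<le> 1" using that by (simp add: is_dist_def)
    then show ?thesis using that(3) by (simp add: log_divide)
  qed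
  have J: "log 2 (1 / P m) \<le> W * real (J P m)" "W * real (J P m) \<le> log 2 (1 / P m) + W"
    "real (J P m) \<le> log 2 (1 / P m) / W + 1"
    if "is_dist N P" "m \<in> {1..N}" "P m > 0" for P m
  proof -
    have "log 2 (1 / P m) / W \<le> real (J P m)" unfolding J_def by (rule real_nat_ceiling_ge)
    then show "log 2 (1 / P m) \<le> W * real (J P m)" using W by (simp add: field_simps)
    have "0 \<le> log 2 (1 / P m) / W" using log_nonneg[OF that] W by simp
    then show "real (J P m) \<le> log 2 (1 / P m) / W + 1" unfolding J_def by linarith
    then show "W * real (J P m) \<le> log 2 (1 / P m) + W" using W by (simp add: field_simps)
  qed
  have l0: "l P (J P m) m = 0" if "is_dist N P" "m \<in> {1..N}" "P m > 0" for P m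
  proof -
    have "(log 2 (1 / P m) - W * real (J P m)) / (2 * \<Delta>) \<le> 0"
      using J(1)[OF that] \<Delta> by (intro divide_nonpos_pos) auto
    then show ?thesis using that by (simp add: l_def level_of_def)
  qed
  have lsub: "{x. l P j x \<le> K} \<subseteq> {1..N}" for P j
    by (auto simp: l_def level_of_def split: if_splits)
  have lev: "level_fun N (d P j) K (l P j)" for P j
    using lsub by (auto simp: level_fun_def d_def)
  have cc1: "cc (d P j) m (l P j) < 2 ^ ss (d P j)" if "l P j m = 0" for P j m
    using cc[of "d P j"] lev that unfolding proper_colouring_def by blast
  \<comment> \<open>Equal codewords have equal threshold, count and colour. With the same threshold,
    closeness to the common \<open>Q\<close> makes the level functions adjacent, so properness of
    the colouring forces equal messages.\<close>
  have sep: "m = m'" if "is_dist N P" "is_dist N P'" "close N \<Delta> P Q" "close N \<Delta> P' Q"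
    "m \<in> {1..N}" "m' \<in> {1..N}" "E P m = E P' m'" for P P' Q m m'
  proof (cases "P m > 0")
    case False
    with that(7) have "\<not> P' m' > 0" by (auto simp: E_def)
    with False that(7) show ?thesis by (auto simp: E_def dest: arg_cong[where f = length])
  next
    case True
    with that(7) have P': "P' m' > 0" by (auto simp: E_def split: if_splits)
    define j where "j = J P m"
    define e where "e = d P j"
    have j': "J P' m' = j" and e': "d P' j = e"
      and col: "b (ss e) (cc e m (l P j)) = b (ss e) (cc e m' (l P' j))"
      using that(7) True P' by (auto simp: E_def unary_prefix_inject j_def e_def)
    have z: "l P j m = 0" "l P' j m' = 0"
      using l0[OF that(1,5) True] l0[OF that(2,6) P'] j' by (auto simp: j_def)
    have "cc e m (l P j) = cc e m' (l P' j)"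
      using col b(1)[of "ss e"] cc1[OF z(1)] cc1[OF z(2)] e' by (auto simp: e_def inj_on_def)
    moreover have "levels_close (l P j) (l P' j)"
      unfolding l_def using levels_close_level_of[OF that(3,4) \<Delta>] .
    ultimately show ?thesis
      using cc[of e] lev[of P j] lev[of P' j] z e' unfolding proper_colouring_def e_def by metis
  qed
  obtain D where D: "\<forall>Q w. D Q w \<in> {1..N}"
    "\<forall>P Q m. is_dist N P \<and> close N \<Delta> P Q \<and> m \<in> {1..N} \<longrightarrow> D Q (E P m) = m"
    using decoder_exists[of N \<Delta> E] sep N by (metis (no_types, lifting) one_le_numeral order_trans)
  have "real (length (E P m)) \<le> log 2 (1 / P m) / W + 24 +
          13 * real (card {x \<in> {1..N}. P x \<ge> P m * 2 powr (- 3 * W)})"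
    if m: "is_dist N P" "m \<in> {1..N}" "P m > 0" for P m
  proof -
    let ?e = "d P (J P m)"
    have "length (E P m) = J P m + ?e + 3 + ss ?e"
      using m cc1[OF l0[OF m]] b(2) by (simp add: E_def)
    also have "\<dots> \<le> J P m + 13 * ?e + 23" using ss[of ?e] by simp
    finally have len: "length (E P m) \<le> J P m + 13 * ?e + 23" .
    have "{x. l P (J P m) x \<le> K} \<subseteq> {x \<in> {1..N}. P x \<ge> P m * 2 powr (- 3 * W)}"
    proof
      fix x assume x: "x \<in> {x. l P (J P m) x \<le> K}"
      then have x1: "x \<in> {1..N}" "P x > 0" by (auto simp: l_def level_of_def split: if_splits)
      with x have "nat \<lceil>(log 2 (1 / P x) - W * real (J P m)) / (2 * \<Delta>)\<rceil> \<le> K"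
        by (simp add: l_def level_of_def)
      then have "(log 2 (1 / P x) - W * real (J P m)) / (2 * \<Delta>) \<le> real K" by linarith
      then have "log 2 (1 / P x) - W * real (J P m) \<le> real K * (2 * \<Delta>)"
        using \<Delta> by (simp add: pos_divide_le_eq)
      also have "\<dots> \<le> 2 * W" using W(2) by (simp add: K_def mult.commute)
      finally have "log 2 (1 / P x) \<le> log 2 (1 / P m) + 3 * W" using J(2)[OF m] by simp
      then have "log 2 (P m) + (- 3 * W) \<le> log 2 (P x)" using x1 m by (simp add: log_divide)
      then have "log 2 (P m * 2 powr (- 3 * W)) \<le> log 2 (P x)" using m by (simp add: log_mult)
      then have "P m * 2 powr (- 3 * W) \<le> P x" using x1 m by (subst (asm) log_le_cancel_iff) auto
      then show "x \<in> {x \<in> {1..N}. P x \<ge> P m * 2 powr (- 3 * W)}" using x1 by simp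
    qed
    then have "?e \<le> card {x \<in> {1..N}. P x \<ge> P m * 2 powr (- 3 * W)}"
      unfolding d_def by (intro card_mono) auto
    then show ?thesis using len J(3)[OF m] by linarith
  qed
  with D show ?thesis by (intro exI[of _ E] exI[of _ D]) blast
qed

section \<open>Expected code length\<close>

lemma close_mono:
  assumes "close N \<Delta> P Q" "\<Delta> \<le> \<Delta>'" "is_dist N P" "is_dist N Q"
  shows "close N \<Delta>' P Q"
  unfolding close_def
proof
  fix m assume m: "m \<in> {1..N}"
  have "2 powr \<Delta> \<le> 2 powr \<Delta>'" using assms(2) by (intro powr_mono) auto
  then have "2 powr \<Delta> * P m \<le> 2 powr \<Delta>' * P m" "2 powr \<Delta> * Q m \<le> 2 powr \<Delta>' * Q m"
    using assms(3,4) m by (auto simp: is_dist_def intro: mult_right_mono)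
  then show "P m \<le> 2 powr \<Delta>' * Q m \<and> Q m \<le> 2 powr \<Delta>' * P m"
    using assms(1) m by (auto simp: close_def intro: order_trans)
qed

text \<open>The codeword length is bounded by an affine function of the excess
  \<open>t m = log 2 (M / Pt m)\<close>, with constant term of order \<open>W / M\<close> and slope
  of order \<open>1 / M\<close>; \<open>expected_excess\<close> then bounds the expectation.\<close>

lemma expected_length_bound:
  assumes P: "is_dist N P" and Pt: "small_level_sets N Pt M" and close: "close N W P Pt"
    and W: "W \<ge> 1"
    and len: "\<And>m. m \<in> {1..N} \<Longrightarrow> P m > 0 \<Longrightarrow>
       real (length (c m)) \<le> log 2 (1 / P m) / W + 24 +
          13 * real (card {x \<in> {1..N}. P x \<ge> P m * 2 powr (- 3 * W)})"
  shows "exp_len N P c \<le> (551 + 66 * excess_const) * W / M"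
proof -
  let ?S = "{m\<in>{1..N}. P m > 0}"
  let ?X = excess_const
  define t where "t m = log 2 (M / Pt m)" for m
  define a where "a = 25 + log 2 (1 / M) + 65 * (1 + 5 * W) / M"
  have M: "0 < M" "M \<le> 1" "\<And>m. m \<in> {1..N} \<Longrightarrow> Pt m \<le> M"
    "\<And>u. u \<ge> 0 \<Longrightarrow> real (card {m \<in> {1..N}. Pt m \<ge> M * 2 powr (- u)}) \<le> 5 * (1 + u) / M"
    using Pt by (auto simp: small_level_sets_def)
  have cl: "P m \<le> 2 powr W * Pt m" "Pt m \<le> 2 powr W * P m" if "m \<in> {1..N}" for m
    using close that by (auto simp: close_def)
  have sum1: "(\<Sum>m\<in>?S. P m) = 1" by (rule sum_support[OF P])
  have lM: "0 \<le> log 2 (1 / M)" using M by (simp add: log_divide)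
  have bound: "real (length (c m)) \<le> a + t m * (1 + 65 / M)" if m: "m \<in> ?S" for m
  proof -
    have Ptm: "Pt m > 0" using close_pos_iff[OF close] m by blast
    have t0: "0 \<le> t m" using Ptm M m by (simp add: t_def zero_le_log_cancel_iff)
    have "log 2 (1 / P m) \<le> log 2 (1 / Pt m) + W" using close_log[OF close, of m] m by auto
    also have "log 2 (1 / Pt m) = log 2 (1 / M) + t m"
      using Ptm M by (simp add: t_def log_divide)
    finally have "log 2 (1 / P m) / W \<le> (log 2 (1 / M) + t m + W) / W"
      using W by (intro divide_right_mono) auto
    also have "\<dots> \<le> log 2 (1 / M) + t m + 1"
    proof -
      have "(log 2 (1 / M) + t m) * 1 \<le> (log 2 (1 / M) + t m) * W"
        using lM t0 W by (intro mult_left_mono) auto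
      then show ?thesis using W by (simp add: field_simps)
    qed
    finally have j: "log 2 (1 / P m) / W \<le> log 2 (1 / M) + t m + 1" .
    \<comment> \<open>In \<open>5 * W\<close>, the scheme accounts for \<open>3 * W\<close>, and
      passing from \<open>P\<close> to \<open>Pt\<close> at \<open>m\<close> and at \<open>x\<close>
      costs \<open>W\<close> each.\<close>
    have "{x \<in> {1..N}. P x \<ge> P m * 2 powr (- 3 * W)}
        \<subseteq> {x \<in> {1..N}. Pt x \<ge> M * 2 powr (- (t m + 5 * W))}"
    proof
      fix x assume x: "x \<in> {x \<in> {1..N}. P x \<ge> P m * 2 powr (- 3 * W)}"
      have "M * 2 powr (- (t m + 5 * W)) = M * (2 powr (- t m) * 2 powr (- 5 * W))"
        by (simp flip: powr_add)
      also have "\<dots> = Pt m * 2 powr (- 5 * W)"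
        using Ptm M by (simp add: t_def powr_minus)
      also have "\<dots> \<le> (2 powr W * P m) * 2 powr (- 5 * W)"
        using cl(2)[of m] m by (intro mult_right_mono) auto
      also have "\<dots> = 2 powr (- W) * (P m * 2 powr (- 3 * W))"
        by (simp add: mult.left_commute flip: powr_add)
      also have "\<dots> \<le> 2 powr (- W) * P x" using x by (intro mult_left_mono) auto
      also have "\<dots> \<le> 2 powr (- W) * (2 powr W * Pt x)"
        using cl(1)[of x] x by (intro mult_left_mono) auto
      also have "\<dots> = Pt x" by (simp add: powr_minus)
      finally show "x \<in> {x \<in> {1..N}. Pt x \<ge> M * 2 powr (- (t m + 5 * W))}" using x by simp
    qed
    then have "card {x \<in> {1..N}. P x \<ge> P m * 2 powr (- 3 * W)}
        \<le> card {x \<in> {1..N}. Pt x \<ge> M * 2 powr (- (t m + 5 * W))}"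
      by (intro card_mono) auto
    also have "real \<dots> \<le> 5 * (1 + (t m + 5 * W)) / M" using t0 W by (intro M(4)) auto
    finally have "13 * real (card {x \<in> {1..N}. P x \<ge> P m * 2 powr (- 3 * W)})
        \<le> 65 * (1 + 5 * W) / M + t m * (65 / M)" using M(1) by (simp add: field_simps)
    then show ?thesis using len[of m] m j by (simp add: a_def algebra_simps)
  qed
  have "(\<Sum>m\<in>?S. P m * t m) \<le> 2 * W + ?X"
    unfolding t_def by (rule expected_excess[OF P Pt cl(1)]) (use W in auto)
  also have "\<dots> \<le> (2 + ?X) * W"
    using mult_left_mono[OF W excess_const_nonneg] by (simp add: algebra_simps)
  finally have Et: "(\<Sum>m\<in>?S. P m * t m) \<le> (2 + ?X) * W" .
  have "exp_len N P c = (\<Sum>m\<in>?S. P m * real (length (c m)))"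
    unfolding exp_len_def
    by (rule sum.mono_neutral_right) (use P in \<open>auto simp: is_dist_def\<close>)
  also have "\<dots> \<le> (\<Sum>m\<in>?S. P m * (a + t m * (1 + 65 / M)))"
    using bound by (intro sum_mono mult_left_mono) auto
  also have "\<dots> = a * (\<Sum>m\<in>?S. P m) + (1 + 65 / M) * (\<Sum>m\<in>?S. P m * t m)"
    by (simp add: sum.distrib sum_distrib_left algebra_simps)
  also have "\<dots> \<le> a + (1 + 65 / M) * ((2 + ?X) * W)"
    using Et M(1) sum1 by (simp add: mult_left_mono)
  also have "\<dots> \<le> (551 + 66 * ?X) * W / M"
  proof -
    \<comment> \<open>Every term is compared with \<open>q\<close>:
      \<open>419 = 25 + 4 + 65 + 325\<close> bounds \<open>a\<close>, and
      \<open>551 = 419 + 2 * 66\<close>.\<close>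
    define q where "q = W / M"
    have M1: "1 \<le> 1 / M" using M by simp
    have Mq: "1 / M \<le> q" unfolding q_def using M W by (intro divide_right_mono) auto
    have "log 2 (1 / M) \<le> 3 + 1 / M / 4" using M(1) by (intro log_le_quarter) simp
    then have lq: "log 2 (1 / M) \<le> 4 * q" using M1 Mq by simp
    have "65 * (1 + 5 * W) / M = 65 * (1 / M) + 325 * q"
      by (simp add: q_def distrib_left add_divide_distrib)
    then have aq: "a \<le> 419 * q" using lq M1 Mq unfolding a_def by linarith
    have "W * 1 \<le> W * (1 / M)" using M1 W by (intro mult_left_mono) auto
    then have "(2 + ?X) * W \<le> (2 + ?X) * q"
      using excess_const_nonneg by (intro mult_left_mono) (auto simp: q_def)
    moreover have "(1 + 65 / M) * ((2 + ?X) * W) = (2 + ?X) * W + 65 * ((2 + ?X) * q)"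
      by (simp add: q_def algebra_simps add_divide_distrib)
    ultimately have "a + (1 + 65 / M) * ((2 + ?X) * W) \<le> 419 * q + 66 * ((2 + ?X) * q)"
      using aq by linarith
    also have "\<dots> = (551 + 66 * ?X) * W / M" by (simp add: q_def algebra_simps add_divide_distrib)
    finally show ?thesis .
  qed
  finally show ?thesis .
qed

theorem mainTheorem14:
  shows "\<exists>C::real. \<forall>N::nat. N \<ge> 2 \<longrightarrow> (\<forall>\<Delta>::real. \<Delta> > 0 \<longrightarrow>
    (\<exists>(E :: (nat \<Rightarrow> real) \<Rightarrow> nat \<Rightarrow> bool list) (D :: (nat \<Rightarrow> real) \<Rightarrow> bool list \<Rightarrow> nat).
       (\<forall>Q w. is_dist N Q \<longrightarrow> D Q w \<in> {1..N}) \<and>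
       (\<forall>P Q m. is_dist N P \<and> is_dist N Q \<and> close N \<Delta> P Q \<and> m \<in> {1..N}
            \<longrightarrow> D Q (E P m) = m) \<and>
       (\<forall>P\<in>Fam N. exp_len N P (E P)
            \<le> C * 2 powr (entropy N P) * real_of_int \<lceil>\<Delta> * real (log_star N)\<rceil>) \<and>
       (\<forall>P Pt. is_dist N P \<and> Pt \<in> Fam N \<and> close N (\<Delta> * real (log_star N)) P Pt
            \<longrightarrow> exp_len N P (E P)
                 \<le> C * 2 powr (entropy N Pt) * real_of_int \<lceil>\<Delta> * real (log_star N)\<rceil>)))"
proof (intro exI[of _ "551 + 66 * excess_const"] allI impI)
  fix N :: nat and \<Delta> :: real assume N: "N \<ge> 2" and \<Delta>: "\<Delta> > 0"
  let ?C = "551 + 66 * excess_const"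
  define W where "W = real_of_int \<lceil>\<Delta> * real (log_star N)\<rceil>"
  \<comment> \<open>Strict positivity makes the ceiling at least 1; it rests on
    \<open>1 \<le> log_star N\<close>.\<close>
  have "0 < \<Delta> * real (log_star N)" using \<Delta> log_iter_log_star(2)[OF N] by simp
  then have W: "W \<ge> 1" "\<Delta> * real (log_star N) \<le> W" by (simp_all add: W_def)
  obtain E :: "(nat \<Rightarrow> real) \<Rightarrow> nat \<Rightarrow> bool list" and D where
    D: "\<forall>Q w. D Q w \<in> {1..N}"
    and ED: "\<forall>P Q m. is_dist N P \<and> close N \<Delta> P Q \<and> m \<in> {1..N} \<longrightarrow> D Q (E P m) = m"
    and len: "\<forall>P m. is_dist N P \<and> m \<in> {1..N} \<and> P m > 0 \<longrightarrow>
       real (length (E P m)) \<le> log 2 (1 / P m) / W + 24 +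
          13 * real (card {x \<in> {1..N}. P x \<ge> P m * 2 powr (- 3 * W)})"
    using scheme_exists[OF N \<Delta> W] by blast
  have bound: "exp_len N P (E P) \<le> ?C * 2 powr (entropy N Pt) * W"
    if P: "is_dist N P" and Pt: "Pt \<in> Fam N" and cl: "close N (\<Delta> * real (log_star N)) P Pt" for P Pt
  proof -
    have dist: "is_dist N Pt" using Pt by (rule Fam_is_dist)
    obtain M where M: "small_level_sets N Pt M" using Fam_level_set[OF Pt] N by auto
    then have M': "0 < M" "\<And>m. m \<in> {1..N} \<Longrightarrow> Pt m \<le> M" by (auto simp: small_level_sets_def)
    have "close N W P Pt" by (rule close_mono[OF cl W(2) P dist])
    then have "exp_len N P (E P) \<le> ?C * W / M"
      using P len W by (intro expected_length_bound[OF P M]) auto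
    also have "\<dots> = (?C * W) * (1 / M)" by simp
    also have "\<dots> \<le> (?C * W) * 2 powr (entropy N Pt)"
      using inverse_max_le_two_powr_entropy[OF dist M'] W excess_const_nonneg
      by (intro mult_left_mono) auto
    finally show ?thesis by (simp only: mult_ac)
  qed
  \<comment> \<open>The bound for members of the families is the case \<open>Pt = P\<close> of
    \<open>bound\<close>.\<close>
  have refl: "close N (\<Delta> * real (log_star N)) P P" if "P \<in> Fam N" for P
    using close_mono[of N 0 P P "\<Delta> * real (log_star N)"] Fam_is_dist[OF that] \<Delta>
    by (simp add: close_def)
  show "\<exists>E D. (\<forall>Q w. is_dist N Q \<longrightarrow> D Q w \<in> {1..N}) \<and>
     (\<forall>P Q m. is_dist N P \<and> is_dist N Q \<and> close N \<Delta> P Q \<and> m \<in> {1..N} \<longrightarrow> D Q (E P m) = m) \<and>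
     (\<forall>P\<in>Fam N. exp_len N P (E P)
        \<le> ?C * 2 powr (entropy N P) * real_of_int \<lceil>\<Delta> * real (log_star N)\<rceil>) \<and>
     (\<forall>P Pt. is_dist N P \<and> Pt \<in> Fam N \<and> close N (\<Delta> * real (log_star N)) P Pt
        \<longrightarrow> exp_len N P (E P)
          \<le> ?C * 2 powr (entropy N Pt) * real_of_int \<lceil>\<Delta> * real (log_star N)\<rceil>)"
    using D ED bound Fam_is_dist refl unfolding W_def by (intro exI[of _ E] exI[of _ D]) blast
qed

end
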